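(* Consider any sequence of spin glass models, with random Gibbs measures $\mu_n$ on $\Sigma_n$, $n\ge1$, that satisfies the generalized Parisi ultrametricity ansatz for some bounded measurable function $f:[-1,1]\to\mathbb{R}$; that is, for all $\epsilon>0$, \[ \lim_{n\to\infty}\mathbb{E}\big\langle \mathbf{1}_{\{f(R_{1,2})\ge\min\{f(R_{1,3}),f(R_{2,3})\}-\epsilon\}}\big\rangle=1 . \] Then there are deterministic sequences $\epsilon_n$ and $\delta_n$ tending to zero such that, with probability at least $1-\epsilon_n$, the following happens. There is a hierarchical clustering of the configuration space $\Sigma_n$ (which may depend on the realization of $\mu_n$) such that the number of clusters is finite, each cluster is measurable, and for each cluster $\alpha$ there is a number $q_\alpha$ that is a function of the depth of $\alpha$ in the hierarchy, with the property that \[ \langle|f(R_{1,2})-q_\alpha|\rangle\le\delta_n, \] where $\alpha=\alpha(\sigma^1,\sigma^2)$ is the smallest cluster containing two configurations $\sigma^1$ and $\sigma^2$ drawn independently from the Gibbs measure $\mu_n$, and $R_{1,2}$ is their overlap.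
   Context: For each $n$, the configuration space $\Sigma_n$ is either the hypercube $\{-1,1\}^n$ (with the power set $\sigma$-algebra) or the sphere of radius $\sqrt n$ centered at the origin in $\mathbb{R}^n$ (with the Borel $\sigma$-algebra). A spin glass model assigns a random probability measure $\mu_n$, called the Gibbs measure, to $\Sigma_n$. The overlap of configurations is $R_{i,j}:=\frac1n\sum_{k=1}^n\sigma^i_k\sigma^j_k\in[-1,1]$, where $\sigma^1,\sigma^2,\ldots$ is an i.i.d. sequence of configurations drawn from $\mu_n$. $\langle\cdot\rangle$ denotes expectation with respect to the Gibbs measure $\mu_n$ (i.e. over $\sigma^1,\sigma^2,\ldots$ with $\mu_n$ fixed), $\mathbb{E}$ denotes expectation with respect to the randomness in $\mu_n$, and "with probability" refers to the randomness in $\mu_n$. Hierarchical clusterings with finitely many measurable clusters correspond to compatible rooted trees: a tree $T$ with root $r$ whose set of leaves (non-root nodes of degree one) is $\Sigma_n$, with $T\setminus\Sigma_n$ finite, and such that for each $v\in T\setminus\Sigma_n$ the set of leaves descending from $v$ is measurable. The clusters are the nodes $v\in T\setminus\Sigma_n$, each viewed as the set of leaves descending from it; the depth of a cluster is its graph distance from $r$; "smallest cluster containing" two configurations means the one lowest down in the hierarchy (of greatest depth). The number of clusters may grow with $n$. *)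

theory Defs
  imports "HOL-Probability.Probability"
begin

section \<open>Spin glass models\<close>

type_synonym config = "nat \<Rightarrow> real"

text \<open>Vectors in \<open>n\<close>-dimensional space are extensional functions on \<open>{1..n}\<close>.
  Only the carrier and the sigma-algebra of the following two measure spaces are used.\<close>

definition hypercube :: "nat \<Rightarrow> config measure" where
  "hypercube n = count_space (Pi\<^sub>E {1..n} (\<lambda>_. {-1, 1}))"

text \<open>The product sigma-algebra on \<open>{1..n}\<close> is the Borel sigma-algebra of Euclidean
  \<open>n\<close>-space; \<^const>\<open>L2_set\<close> is the Euclidean norm.\<close>

definition sphere_space :: "nat \<Rightarrow> config measure" where
  "sphere_space n =
     restrict_space (PiM {1..n} (\<lambda>_. borel)) {\<sigma>. L2_set \<sigma> {1..n} = sqrt (real n)}"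

definition overlap :: "nat \<Rightarrow> config \<Rightarrow> config \<Rightarrow> real" where
  "overlap n \<sigma> \<tau> = (1 / real n) * (\<Sum>k\<in>{1..n}. \<sigma> k * \<tau> k)"

text \<open>Expectation of a function of an i.i.d. sequence \<open>s 1, s 2, \<dots>\<close> of
  configurations drawn from the (fixed) probability measure \<open>G\<close>.\<close>

definition gibbs_avg :: "config measure \<Rightarrow> ((nat \<Rightarrow> config) \<Rightarrow> real) \<Rightarrow> real" where
  "gibbs_avg G F = (\<integral>s. F s \<partial>(PiM {1::nat..} (\<lambda>_. G)))"

text \<open>\<open>\<Sigma> n\<close> is the configuration space, \<open>P n\<close> the probability space carrying the
  randomness of the Gibbs measure \<open>\<mu> n\<close>.\<close>

definition spin_glass_models ::
    "(nat \<Rightarrow> config measure) \<Rightarrow> (nat \<Rightarrow> 'w measure) \<Rightarrow> (nat \<Rightarrow> 'w \<Rightarrow> config measure) \<Rightarrow> bool" where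
  "spin_glass_models \<Sigma> P \<mu> \<longleftrightarrow>
     (\<forall>n\<ge>1. (\<Sigma> n = hypercube n \<or> \<Sigma> n = sphere_space n) \<and>
            prob_space (P n) \<and>
            \<mu> n \<in> P n \<rightarrow>\<^sub>M prob_algebra (\<Sigma> n))"

definition generalized_parisi_ansatz ::
    "(nat \<Rightarrow> 'w measure) \<Rightarrow> (nat \<Rightarrow> 'w \<Rightarrow> config measure) \<Rightarrow> (real \<Rightarrow> real) \<Rightarrow> bool" where
  "generalized_parisi_ansatz P \<mu> f \<longleftrightarrow>
     (\<forall>e>0. (\<lambda>n. \<integral>\<omega>. gibbs_avg (\<mu> n \<omega>)
                  (\<lambda>s. of_bool (f (overlap n (s 1) (s 2)) \<ge>
                     min (f (overlap n (s 1) (s 3))) (f (overlap n (s 2) (s 3))) - e)) \<partial>P n)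
            \<longlonglongrightarrow> 1)"


section \<open>Rooted trees\<close>

text \<open>Graphs are given by a vertex set \<open>V\<close> and a symmetric irreflexive edge relation \<open>E\<close>;
  vertices may have infinite degree. A path is given by its list of vertices, so
  its length is one less than that of the list.\<close>

definition simple_graph :: "'v set \<Rightarrow> ('v \<times> 'v) set \<Rightarrow> bool" where
  "simple_graph V E \<longleftrightarrow> E \<subseteq> V \<times> V \<and> sym E \<and> irrefl E"

definition graph_path :: "'v set \<Rightarrow> ('v \<times> 'v) set \<Rightarrow> 'v \<Rightarrow> 'v list \<Rightarrow> 'v \<Rightarrow> bool" where
  "graph_path V E u p v \<longleftrightarrow>
     p \<noteq> [] \<and> hd p = u \<and> last p = v \<and> set p \<subseteq> V \<and> distinct p \<and>
     successively (\<lambda>x y. (x, y) \<in> E) p"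

definition rooted_tree :: "'v set \<Rightarrow> ('v \<times> 'v) set \<Rightarrow> 'v \<Rightarrow> bool" where
  "rooted_tree V E r \<longleftrightarrow>
     simple_graph V E \<and> r \<in> V \<and> (\<forall>u\<in>V. \<forall>v\<in>V. \<exists>!p. graph_path V E u p v)"

text \<open>\<^const>\<open>card\<close> is 0 on infinite sets, so this does select the vertices with exactly
  one neighbour.\<close>

definition tree_leaves :: "'v set \<Rightarrow> ('v \<times> 'v) set \<Rightarrow> 'v \<Rightarrow> 'v set" where
  "tree_leaves V E r = {v \<in> V. v \<noteq> r \<and> card {w. (v, w) \<in> E} = 1}"

definition descends_from :: "'v set \<Rightarrow> ('v \<times> 'v) set \<Rightarrow> 'v \<Rightarrow> 'v \<Rightarrow> 'v \<Rightarrow> bool" where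
  "descends_from V E r u v \<longleftrightarrow> (\<exists>p. graph_path V E r p u \<and> v \<in> set p)"

definition depth :: "'v set \<Rightarrow> ('v \<times> 'v) set \<Rightarrow> 'v \<Rightarrow> 'v \<Rightarrow> nat" where
  "depth V E r v = (LEAST d. \<exists>p. graph_path V E r p v \<and> length p = Suc d)"


section \<open>Hierarchical clusterings\<close>

text \<open>Since a hierarchical clustering has only finitely many clusters, there is no loss in
  drawing the names of the inner nodes from the natural numbers.\<close>

datatype node = Config config | Inner nat

definition clusters :: "node set \<Rightarrow> (node \<times> node) set \<Rightarrow> node \<Rightarrow> node set" where
  "clusters V E r = V - tree_leaves V E r"

definition cluster_set :: "node set \<Rightarrow> (node \<times> node) set \<Rightarrow> node \<Rightarrow> node \<Rightarrow> config set" where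
  "cluster_set V E r \<alpha> = {\<sigma>. Config \<sigma> \<in> tree_leaves V E r \<and> descends_from V E r (Config \<sigma>) \<alpha>}"

definition hierarchical_clustering ::
    "config measure \<Rightarrow> node set \<Rightarrow> (node \<times> node) set \<Rightarrow> node \<Rightarrow> bool" where
  "hierarchical_clustering M V E r \<longleftrightarrow>
     rooted_tree V E r \<and>
     tree_leaves V E r = Config ` space M \<and>
     finite (clusters V E r) \<and>
     (\<forall>\<alpha>\<in>clusters V E r. cluster_set V E r \<alpha> \<in> sets M)"

text \<open>The clusters containing a given configuration form the path from the root to it, so
  the maximizer is unique. For \<open>\<sigma> = \<tau>\<close> it is the parent of the leaf \<open>\<sigma>\<close>.\<close>

definition smallest_cluster ::
    "node set \<Rightarrow> (node \<times> node) set \<Rightarrow> node \<Rightarrow> config \<Rightarrow> config \<Rightarrow> node" where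
  "smallest_cluster V E r \<sigma> \<tau> =
     (ARG_MAX (depth V E r) \<alpha>.
        \<alpha> \<in> clusters V E r \<and> \<sigma> \<in> cluster_set V E r \<alpha> \<and> \<tau> \<in> cluster_set V E r \<alpha>)"

end

theory Submission
  imports Defs "HOL-Library.Sublist"
begin

text \<open>Fix a level \<open>t\<close>. If the window \<open>[t - e, t)\<close> carries little mass, approximate ultrametricity
  makes \<open>f(R) \<ge> t\<close> an almost transitive relation. Such a relation is close to a partition: choose
  \<open>m\<close> centers and put each configuration into the class of the first center it is related to. A pair
  classified wrongly either forms, with some center, a triple in which exactly two of the three
  relations hold, or consists of related points missed by all centers; for random centers the second
  event has probability at most \<open>E[d (1 - d)^m] \<le> 1 / (m + 1)\<close>, \<open>d\<close> being the measure of the points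
  related to a given one. Intersecting the partitions for \<open>k\<close> levels of spacing about \<open>1 / k\<close>
  gives a tree in which the depth of the smallest common cluster determines \<open>f(R)\<close> up to \<open>O(1 / k)\<close>;
  finally \<open>k\<close> is sent to infinity slowly with \<open>n\<close>.\<close>

section \<open>Rooted trees given by a parent function\<close>

text \<open>The thresholds have to depend on the realization, since nothing prevents
  \<open>f(R)\<close> from charging a prescribed level; but \<open>q\<close> may depend on the depth
  only. So level \<open>j\<close> is searched within its own fixed interval of length
  \<open>2 * B / k\<close>, and the left end of interval \<open>d\<close> serves as \<open>q\<close>
  at depth \<open>d\<close>. The partitions for different levels come from separately chosen centers
  and need not be nested. A configuration therefore carries the list of its labels, cut at the first
  level where it is related to no center, and the tree is the prefix tree of these lists. Each level
  costs \<open>6 * m / N + 1 / (m + 1)\<close> with \<open>m\<close> centers and \<open>N\<close>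
  candidate windows; over \<open>k\<close> levels this must sum to \<open>O(1 / k)\<close>, whence
  \<open>m = k ^ 2\<close>, \<open>N = k ^ 4\<close> and windows of width
  \<open>2 * B / k ^ 5\<close>. The ansatz gives no rate for the mass of the violating triples,
  which has to fall below \<open>1 / k ^ 4\<close>; this is why \<open>k\<close> is chosen by a
  diagonal argument, combined with Markov's inequality.\<close>

lemma ex_graph_path_of_walk:
  assumes "p \<noteq> []" "set p \<subseteq> V" "successively (\<lambda>x y. (x, y) \<in> E) p"
  shows "\<exists>p'. graph_path V E (hd p) p' (last p)"
  using assms
proof (induction "length p" arbitrary: p rule: less_induct)
  case less
  show ?case
  proof (cases "distinct p")
    case True
    with less.prems show ?thesis by (auto simp: graph_path_def)
  next
    case False
    then obtain a x b c where p: "p = a @ [x] @ b @ [x] @ c"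
      using not_distinct_decomp by blast
    \<comment> \<open>Dropping the loop between the two visits of \<open>x\<close> gives a shorter
      walk with the same ends.\<close>
    let ?p = "a @ [x] @ c"
    have "successively (\<lambda>x y. (x, y) \<in> E) ?p"
      using less.prems(3) unfolding p by (auto simp: successively_append_iff successively_Cons split: if_splits)
    with less.prems(2) have "\<exists>p'. graph_path V E (hd ?p) p' (last ?p)"
      by (intro less.hyps) (auto simp: p)
    then show ?thesis by (cases a) (auto simp: p)
  qed
qed

lemma graph_path_rev:
  assumes "sym E" "graph_path V E u p v"
  shows "graph_path V E v (rev p) u"
proof -
  have "successively (\<lambda>x y. (y, x) \<in> E) p"
    using assms by (auto simp: graph_path_def intro: successively_mono dest: symD)
  then show ?thesis
    using assms by (auto simp: graph_path_def hd_rev last_rev)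
qed

text \<open>\<open>up v\<close> stands for the path from the root to \<open>v\<close>. Making it a
  parameter replaces a well-foundedness assumption on \<open>par\<close>: its length drops by one
  along \<open>par\<close> and drives the inductions.\<close>

locale parent_tree =
  fixes V :: "'v set" and r :: 'v and par :: "'v \<Rightarrow> 'v" and up :: "'v \<Rightarrow> 'v list"
  assumes root_in: "r \<in> V"
    and up_root: "up r = [r]"
    and par_in: "v \<in> V \<Longrightarrow> v \<noteq> r \<Longrightarrow> par v \<in> V"
    and up_par: "v \<in> V \<Longrightarrow> v \<noteq> r \<Longrightarrow> up v = up (par v) @ [v]"
begin

definition edges :: "('v \<times> 'v) set" where
  "edges = {(u, v). u \<in> V \<and> v \<in> V \<and> (u \<noteq> r \<and> v = par u \<or> v \<noteq> r \<and> u = par v)}"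

lemma length_up_par: "v \<in> V \<Longrightarrow> v \<noteq> r \<Longrightarrow> length (up v) = Suc (length (up (par v)))"
  by (simp add: up_par)

lemma sym_edges: "sym edges"
  by (auto simp: edges_def sym_def)

lemma simple_graph_edges: "simple_graph V edges"
  using sym_edges length_up_par by (auto simp: simple_graph_def edges_def irrefl_def) (metis n_not_Suc_n)

lemma up_not_Nil: "v \<in> V \<Longrightarrow> up v \<noteq> []"
  using up_root up_par by (cases "v = r") auto

text \<open>The bound on the members of \<open>up v\<close> strengthens the induction:
  \<open>v\<close> has a longer \<open>up\<close> than everything on the path to its parent, so
  appending it keeps the path simple.\<close>

lemma graph_path_up:
  assumes "v \<in> V"
  shows "graph_path V edges r (up v) v \<and> (\<forall>w\<in>set (up v). length (up w) \<le> length (up v))"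
  using assms
proof (induction "length (up v)" arbitrary: v rule: less_induct)
  case less
  show ?case
  proof (cases "v = r")
    case True
    with root_in show ?thesis by (auto simp: graph_path_def up_root)
  next
    case False
    let ?u = "par v"
    have lt: "length (up ?u) < length (up v)"
      using less.prems False length_up_par by auto
    have u: "?u \<in> V" using less.prems False par_in by auto
    note IH = less.hyps[OF lt u]
    have e: "(?u, v) \<in> edges" using less.prems False u by (auto simp: edges_def)
    have nin: "v \<notin> set (up ?u)" using IH lt by auto
    have "graph_path V edges r (up v) v"
      using IH e nin less.prems
      by (auto simp: graph_path_def up_par[OF less.prems False] successively_append_iff)
    moreover have "\<forall>w\<in>set (up v). length (up w) \<le> length (up v)"
      using IH lt up_par[OF less.prems False] by auto
    ultimately show ?thesis by blast
  qed
qed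

text \<open>A simple path that has once stepped away from the root can never turn back.\<close>

lemma descending_path:
  assumes "distinct (u # w # p)" "successively (\<lambda>x y. (x, y) \<in> edges) (u # w # p)"
    and "w \<noteq> r" "u = par w" "w \<in> V"
  shows "length (up u) < length (up (last (w # p)))"
  using assms
proof (induction p arbitrary: u w)
  case Nil
  then show ?case using length_up_par by auto
next
  case (Cons x p)
  have "(w, x) \<in> edges" using Cons.prems by (auto simp: successively_Cons)
  moreover have "x \<noteq> par w" using Cons.prems by auto
  ultimately have x: "x \<noteq> r" "w = par x" "x \<in> V" by (auto simp: edges_def)
  have "length (up w) < length (up (last (x # p)))"
    using Cons.prems x by (intro Cons.IH) (auto simp: successively_Cons)
  moreover have "length (up u) < length (up w)" using Cons.prems length_up_par by auto
  ultimately show ?case by simp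
qed

text \<open>If \<open>u\<close> is at least as deep as \<open>v\<close>, the first step is forced: a
  step to a child would, by \<open>descending_path\<close>, make the path end strictly deeper than
  \<open>u\<close>. So both paths begin with the edge to \<open>par u\<close>, which is stripped
  off; if \<open>v\<close> is the deeper end, the paths are reversed first.\<close>

lemma graph_path_unique:
  assumes "graph_path V edges u p v" "graph_path V edges u p' v"
  shows "p = p'"
  using assms
proof (induction "length (up u) + length (up v)" arbitrary: u v p p' rule: less_induct)
  case less
  have trivial: "q = [u]" if "graph_path V edges u q u" for q u
    using that by (cases q) (auto simp: graph_path_def split: if_splits)
  have step: "\<exists>q'. q = u # q' \<and> u \<in> V \<and> u \<noteq> r \<and> graph_path V edges (par u) q' v"
    if q: "graph_path V edges u q v" and ne: "u \<noteq> v" and le: "length (up v) \<le> length (up u)" for q u v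
  proof -
    obtain w q' where qq: "q = u # w # q'"
      using q ne unfolding graph_path_def by (metis last_ConsL list.collapse list.exhaust_sel)
    have e: "(u, w) \<in> edges" using q by (auto simp: qq graph_path_def)
    have "\<not> (w \<noteq> r \<and> u = par w)"
      using descending_path[of u w q'] q le e by (auto simp: qq graph_path_def edges_def)
    with e have "u \<noteq> r" "w = par u" "u \<in> V" by (auto simp: edges_def)
    with q show ?thesis by (auto simp: qq graph_path_def)
  qed
  consider "u = v" | "u \<noteq> v" "length (up v) \<le> length (up u)" | "u \<noteq> v" "length (up u) \<le> length (up v)"
    by linarith
  then show ?case
  proof cases
    case 1
    with less.prems trivial show ?thesis by metis
  next
    case 2
    obtain q q' where *: "p = u # q" "p' = u # q'" "u \<in> V" "u \<noteq> r"
      "graph_path V edges (par u) q v" "graph_path V edges (par u) q' v"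
      using step[OF less.prems(1) 2] step[OF less.prems(2) 2] by auto
    have "q = q'" by (rule less.hyps[OF _ *(5,6)]) (use length_up_par[OF *(3,4)] in simp)
    with * show ?thesis by simp
  next
    case 3
    note r1 = graph_path_rev[OF sym_edges less.prems(1)]
    note r2 = graph_path_rev[OF sym_edges less.prems(2)]
    obtain q q' where *: "rev p = v # q" "rev p' = v # q'" "v \<in> V" "v \<noteq> r"
      "graph_path V edges (par v) q u" "graph_path V edges (par v) q' u"
      using step[OF r1 3(1)[symmetric] 3(2)] step[OF r2 3(1)[symmetric] 3(2)] by auto
    have "q = q'" by (rule less.hyps[OF _ *(5,6)]) (use length_up_par[OF *(3,4)] in simp)
    with * show ?thesis by (metis rev_rev_ident)
  qed
qed

lemma rooted_tree_edges: "rooted_tree V edges r"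
  unfolding rooted_tree_def
proof (intro conjI ballI)
  fix u v assume u: "u \<in> V" and v: "v \<in> V"
  have pu: "graph_path V edges u (rev (up u)) r"
    using graph_path_rev[OF sym_edges] graph_path_up[OF u] by blast
  have pv: "graph_path V edges r (up v) v" using graph_path_up[OF v] by blast
  obtain t where t: "up v = r # t" using pv by (cases "up v") (auto simp: graph_path_def)
  \<comment> \<open>Climb to the root and come down again; \<open>t\<close> omits the root, which
    already ends \<open>rev (up u)\<close>. The two halves may share further vertices, so this is
    only a walk.\<close>
  let ?w = "rev (up u) @ t"
  have "\<exists>p. graph_path V edges (hd ?w) p (last ?w)"
    using pu pv unfolding t
    by (intro ex_graph_path_of_walk) (auto simp: graph_path_def successively_append_iff successively_Cons last_rev)
  moreover have "hd ?w = u" using pu by (auto simp: graph_path_def)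
  moreover have "last ?w = v" using pu pv unfolding t by (auto simp: graph_path_def last_rev)
  ultimately have "\<exists>p. graph_path V edges u p v" by simp
  then show "\<exists>!p. graph_path V edges u p v" using graph_path_unique by blast
qed (use simple_graph_edges root_in in auto)

lemma descends_from_iff: "u \<in> V \<Longrightarrow> descends_from V edges r u v \<longleftrightarrow> v \<in> set (up u)"
  using graph_path_up graph_path_unique unfolding descends_from_def by blast

lemma depth_eq: "v \<in> V \<Longrightarrow> depth V edges r v = length (up v) - 1"
  unfolding depth_def
proof (rule Least_equality)
  assume v: "v \<in> V"
  then show "\<exists>p. graph_path V edges r p v \<and> length p = Suc (length (up v) - 1)"
    using graph_path_up[OF v] up_not_Nil[OF v] by (intro exI[of _ "up v"]) (auto simp: Suc_pred)
  show "\<And>d. \<exists>p. graph_path V edges r p v \<and> length p = Suc d \<Longrightarrow> length (up v) - 1 \<le> d"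
    using graph_path_up[OF v] graph_path_unique by fastforce
qed

end

section \<open>Trees of clusters from lists of labels\<close>

text \<open>The tree is a trie: inner nodes are the prefixes of the label lists, and the leaf of
  \<sigma> hangs below the node of \<open>L \<sigma>\<close>. The clusters shared by two
  configurations are then the common prefixes of their lists, and the depth of a cluster is the
  length of its list.\<close>

lemma ex_hierarchical_clustering:
  fixes L :: "config \<Rightarrow> nat list"
  assumes ne: "space M \<noteq> {}"
    and fin: "finite (L ` space M)"
    and meas: "\<And>l. {\<sigma> \<in> space M. prefix l (L \<sigma>)} \<in> sets M"
  shows "\<exists>V E r. hierarchical_clustering M V E r \<and>
    (\<forall>\<sigma>\<in>space M. \<forall>\<tau>\<in>space M. depth V E r (smallest_cluster V E r \<sigma> \<tau>) =
      length (longest_common_prefix (L \<sigma>) (L \<tau>)))"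
proof -
  define inn :: "nat list \<Rightarrow> node" where "inn l = Inner (to_nat l)" for l
  have inn_eq [simp]: "inn l = inn l' \<longleftrightarrow> l = l'" for l l' by (simp add: inn_def)
  have inn_ne [simp]: "inn l \<noteq> Config \<sigma>" "Config \<sigma> \<noteq> inn l" for l \<sigma> by (simp_all add: inn_def)
  define Pr where "Pr = {l. \<exists>\<sigma>\<in>space M. prefix l (L \<sigma>)}"
  define V where "V = inn ` Pr \<union> Config ` space M"
  define r where "r = inn []"
  define par where "par v = (case v of Config \<sigma> \<Rightarrow> inn (L \<sigma>) | Inner n \<Rightarrow> inn (butlast (from_nat n)))" for v
  define up where "up v = (case v of Config \<sigma> \<Rightarrow> map inn (prefixes (L \<sigma>)) @ [Config \<sigma>]
    | Inner n \<Rightarrow> map inn (prefixes (from_nat n)))" for v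
  have par_simps [simp]: "par (inn l) = inn (butlast l)" "par (Config \<sigma>) = inn (L \<sigma>)" for l \<sigma>
    by (simp_all add: par_def inn_def)
  have up_simps [simp]: "up (inn l) = map inn (prefixes l)"
    "up (Config \<sigma>) = map inn (prefixes (L \<sigma>)) @ [Config \<sigma>]" for l \<sigma>
    by (simp_all add: up_def inn_def)
  have nil_in: "[] \<in> Pr" using ne by (auto simp: Pr_def)
  have L_in: "L \<sigma> \<in> Pr" if "\<sigma> \<in> space M" for \<sigma> using that by (auto simp: Pr_def)
  have prefix_in: "l' \<in> Pr" if "l \<in> Pr" "prefix l' l" for l l'
    using that by (auto simp: Pr_def intro: prefix_order.trans)
  have butlast_in: "butlast l \<in> Pr" if "l \<in> Pr" for l
    using that prefix_in prefixeq_butlast by blast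
  interpret T: parent_tree V r par up
  proof
    show "r \<in> V" using nil_in by (auto simp: V_def r_def)
    show "up r = [r]" by (simp add: r_def)
    fix v assume v: "v \<in> V" "v \<noteq> r"
    show "par v \<in> V" using v butlast_in L_in by (auto simp: V_def)
    show "up v = up (par v) @ [v]"
    proof (cases "v \<in> Config ` space M")
      case False
      then obtain l where l: "v = inn l" using v by (auto simp: V_def)
      with v have "l \<noteq> []" by (auto simp: r_def)
      then have "prefixes l = prefixes (butlast l) @ [l]"
        using prefixes_snoc[of "butlast l" "last l"] by simp
      then show ?thesis by (simp add: l)
    qed auto
  qed
  let ?E = T.edges
  have leaves: "tree_leaves V ?E r = Config ` space M"
  proof (rule set_eqI)
    fix v
    show "v \<in> tree_leaves V ?E r \<longleftrightarrow> v \<in> Config ` space M"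
    proof (cases "v \<in> Config ` space M")
      case True
      then obtain \<sigma> where \<sigma>: "v = Config \<sigma>" "\<sigma> \<in> space M" by auto
      have "{w. (v, w) \<in> ?E} = {inn (L \<sigma>)}"
      proof (rule set_eqI)
        fix w
        show "w \<in> {w. (v, w) \<in> ?E} \<longleftrightarrow> w \<in> {inn (L \<sigma>)}"
          using \<sigma> L_in[OF \<sigma>(2)] unfolding T.edges_def by (auto simp: V_def r_def)
      qed
      then show ?thesis using \<sigma> by (auto simp: tree_leaves_def V_def r_def)
    next
      case False
      have "v \<notin> tree_leaves V ?E r"
      proof
        assume v: "v \<in> tree_leaves V ?E r"
        then have vV: "v \<in> V" "v \<noteq> r" and c: "card {w. (v, w) \<in> ?E} = 1" by (auto simp: tree_leaves_def)
        then obtain l where l: "v = inn l" "l \<in> Pr" using False by (auto simp: V_def)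
        with vV have "l \<noteq> []" by (auto simp: r_def)
        obtain \<sigma> where \<sigma>: "\<sigma> \<in> space M" "prefix l (L \<sigma>)" using l by (auto simp: Pr_def)
        \<comment> \<open>A child of \<open>v\<close>: the configuration itself if its list ends
          here, otherwise the next longer prefix. It lies deeper than \<open>v\<close>, hence
          differs from the parent, and \<open>v\<close> has two neighbours.\<close>
        obtain w where w: "w \<in> V" "w \<noteq> r" "par w = v"
        proof (cases "l = L \<sigma>")
          case True
          then show ?thesis using that[of "Config \<sigma>"] \<sigma> l by (auto simp: V_def r_def)
        next
          case False
          then obtain x where x: "prefix (l @ [x]) (L \<sigma>)"
            using \<sigma>(2) by (metis append_one_prefix prefix_length_less strict_prefix_def)
          then have "l @ [x] \<in> Pr" using \<sigma> by (auto simp: Pr_def)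
          then show ?thesis using that[of "inn (l @ [x])"] l by (auto simp: V_def r_def)
        qed
        have "par v \<noteq> w"
        proof
          assume "par v = w"
          then have "length (up v) = Suc (length (up w))" "length (up w) = Suc (length (up v))"
            using T.length_up_par[OF vV] T.length_up_par[OF w(1,2)] unfolding w(3) by simp_all
          then show False by simp
        qed
        moreover have "(v, par v) \<in> ?E" "(v, w) \<in> ?E"
          using vV w T.par_in[of v] by (auto simp: T.edges_def)
        ultimately show False
          using c by (metis (no_types, lifting) card_1_singletonE mem_Collect_eq singletonD)
      qed
      with False show ?thesis by blast
    qed
  qed
  have clusters: "clusters V ?E r = inn ` Pr"
    unfolding clusters_def leaves by (auto simp: V_def)
  have cset: "cluster_set V ?E r (inn l) = {\<sigma> \<in> space M. prefix l (L \<sigma>)}" for l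
    using T.descends_from_iff[of "Config _"]
    unfolding cluster_set_def leaves by (auto simp: V_def)
  have "finite Pr"
  proof -
    have "Pr = (\<Union>l\<in>L ` space M. set (prefixes l))" by (auto simp: Pr_def)
    moreover have "finite (\<Union>l\<in>L ` space M. set (prefixes l))" by (rule finite_UN_I[OF fin]) simp
    ultimately show ?thesis by simp
  qed
  then have hc: "hierarchical_clustering M V ?E r"
    using T.rooted_tree_edges meas unfolding hierarchical_clustering_def clusters leaves by (auto simp: cset)
  have "depth V ?E r (smallest_cluster V ?E r \<sigma> \<tau>) = length (longest_common_prefix (L \<sigma>) (L \<tau>))"
    if st: "\<sigma> \<in> space M" "\<tau> \<in> space M" for \<sigma> \<tau>
  proof -
    let ?l = "longest_common_prefix (L \<sigma>) (L \<tau>)"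
    let ?C = "\<lambda>\<alpha>. \<alpha> \<in> clusters V ?E r \<and> \<sigma> \<in> cluster_set V ?E r \<alpha> \<and> \<tau> \<in> cluster_set V ?E r \<alpha>"
    have d: "depth V ?E r (inn l) = length l" if "l \<in> Pr" for l
      using T.depth_eq[of "inn l"] that by (auto simp: V_def)
    have lP: "?l \<in> Pr" using prefix_in[OF L_in[OF st(1)] longest_common_prefix_prefix1] .
    have "depth V ?E r (arg_max (depth V ?E r) ?C) = depth V ?E r (inn ?l)"
    proof (rule arg_max_equality)
      show "?C (inn ?l)"
        using lP st longest_common_prefix_prefix1 longest_common_prefix_prefix2
        by (auto simp: clusters cset)
      fix \<alpha> assume "?C \<alpha>"
      then obtain l where l: "\<alpha> = inn l" "l \<in> Pr" "prefix l (L \<sigma>)" "prefix l (L \<tau>)"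
        by (auto simp: clusters cset)
      then show "depth V ?E r \<alpha> \<le> depth V ?E r (inn ?l)"
        using d lP longest_common_prefix_max_prefix[of l "L \<sigma>" "L \<tau>"] prefix_length_le by auto
    qed
    then show ?thesis using d[OF lP] by (simp add: smallest_cluster_def)
  qed
  with hc show ?thesis by blast
qed

section \<open>Almost transitive relations\<close>

text \<open>The averaging step of \<open>ex_centers\<close>: a function cannot exceed its own mean
  everywhere.\<close>

lemma (in prob_space) ex_le_nn_integral:
  assumes F [measurable]: "F \<in> borel_measurable M"
  shows "\<exists>z\<in>space M. F z \<le> (\<integral>\<^sup>+ z. F z \<partial>M)"
proof (rule ccontr)
  let ?c = "\<integral>\<^sup>+ z. F z \<partial>M"
  assume "\<not> ?thesis"
  then have gt: "\<And>z. z \<in> space M \<Longrightarrow> ?c < F z" by (auto simp: not_le)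
  obtain z where "z \<in> space M" using not_empty by blast
  \<comment> \<open>Being strictly below a value of \<open>F\<close> makes the mean finite, as the
    strict comparison of integrals requires.\<close>
  with gt have fin: "?c \<noteq> \<infinity>" by fastforce
  have "(\<integral>\<^sup>+ z. ?c \<partial>M) < (\<integral>\<^sup>+ z. F z \<partial>M)"
  proof (rule nn_integral_less)
    show "(\<integral>\<^sup>+ z. ?c \<partial>M) \<noteq> \<infinity>" using fin by (simp add: emeasure_space_1)
    show "AE z in M. ?c \<le> F z" using gt by (auto intro!: AE_I2 less_imp_le)
    show "\<not> (AE z in M. F z \<le> ?c)"
    proof
      assume "AE z in M. F z \<le> ?c"
      then have "AE z in M. False" by (rule AE_mp) (use gt in \<open>auto intro!: AE_I2 simp: not_le\<close>)
      then show False using AE_False by simp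
    qed
  qed auto
  then show False by (simp add: emeasure_space_1)
qed

lemma (in prob_space) nn_integral_swap:
  assumes "case_prod f \<in> borel_measurable (M \<Otimes>\<^sub>M M)"
  shows "(\<integral>\<^sup>+ x. \<integral>\<^sup>+ y. f x y \<partial>M \<partial>M) = (\<integral>\<^sup>+ y. \<integral>\<^sup>+ x. f x y \<partial>M \<partial>M)"
proof -
  interpret pair_sigma_finite M M ..
  show ?thesis using Fubini'[OF assms] by simp
qed

text \<open>The method of conditional expectations, in place of a product of \<open>m\<close> copies of \<open>M\<close>.\<close>

lemma (in prob_space) ex_centers:
  fixes C h :: "'a \<Rightarrow> ennreal" and W :: "'a \<Rightarrow> 'a \<Rightarrow> ennreal"
  assumes C [measurable]: "C \<in> borel_measurable M"
    and W [measurable]: "case_prod W \<in> borel_measurable (M \<Otimes>\<^sub>M M)"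
    and h [measurable]: "h \<in> borel_measurable M"
  shows "\<exists>z :: nat \<Rightarrow> 'a. (\<forall>i. z i \<in> space M) \<and>
    (\<Sum>i<m. C (z i)) + (\<integral>\<^sup>+ x. h x * (\<Prod>i<m. W x (z i)) \<partial>M)
      \<le> of_nat m * (\<integral>\<^sup>+ z. C z \<partial>M) + (\<integral>\<^sup>+ x. h x * (\<integral>\<^sup>+ z. W x z \<partial>M) ^ m \<partial>M)"
  using h
proof (induction m arbitrary: h)
  case 0
  then show ?case using not_empty by (auto intro!: exI[of _ "\<lambda>_. SOME x. x \<in> space M"] simp: some_in_eq)
next
  case (Suc m)
  note [measurable] = Suc.prems
  \<comment> \<open>The center still to be chosen is first averaged out: its factor
    \<open>?u x\<close> moves into the weight, which is why the induction runs over arbitrary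
    \<open>h\<close>.\<close>
  let ?u = "\<lambda>x. \<integral>\<^sup>+ z. W x z \<partial>M"
  have "(\<lambda>x. h x * ?u x) \<in> borel_measurable M" by measurable
  from Suc.IH[OF this] obtain z where zs: "\<forall>i. z i \<in> space M" and
    z: "(\<Sum>i<m. C (z i)) + (\<integral>\<^sup>+ x. h x * ?u x * (\<Prod>i<m. W x (z i)) \<partial>M)
      \<le> of_nat m * (\<integral>\<^sup>+ z. C z \<partial>M) + (\<integral>\<^sup>+ x. h x * ?u x * ?u x ^ m \<partial>M)"
    by blast
  have [measurable]: "z i \<in> space M" for i using zs by blast
  have Wz [measurable]: "(\<lambda>x. W x (z i)) \<in> borel_measurable M" for i by measurable
  define H where "H x = h x * (\<Prod>i<m. W x (z i))" for x
  have [measurable]: "H \<in> borel_measurable M" unfolding H_def by measurable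
  \<comment> \<open>The part of the total that depends on the last center; its mean is the mean of
    \<open>C\<close> plus the integral controlled by the induction hypothesis.\<close>
  define F where "F w = C w + (\<integral>\<^sup>+ x. H x * W x w \<partial>M)" for w
  have [measurable]: "F \<in> borel_measurable M" unfolding F_def by measurable
  obtain w where w: "w \<in> space M" "F w \<le> (\<integral>\<^sup>+ w. F w \<partial>M)"
    using ex_le_nn_integral[of F] by auto
  have "(\<integral>\<^sup>+ w. F w \<partial>M) = (\<integral>\<^sup>+ z. C z \<partial>M) + (\<integral>\<^sup>+ w. \<integral>\<^sup>+ x. H x * W x w \<partial>M \<partial>M)"
    unfolding F_def by (rule nn_integral_add) measurable
  also have "(\<integral>\<^sup>+ w. \<integral>\<^sup>+ x. H x * W x w \<partial>M \<partial>M) = (\<integral>\<^sup>+ x. \<integral>\<^sup>+ w. H x * W x w \<partial>M \<partial>M)"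
    by (rule nn_integral_swap[symmetric]) measurable
  also have "\<dots> = (\<integral>\<^sup>+ x. h x * ?u x * (\<Prod>i<m. W x (z i)) \<partial>M)"
    by (intro nn_integral_cong, subst nn_integral_cmult) (auto simp: H_def mult_ac)
  finally have Fw: "F w \<le> (\<integral>\<^sup>+ z. C z \<partial>M) + (\<integral>\<^sup>+ x. h x * ?u x * (\<Prod>i<m. W x (z i)) \<partial>M)"
    using w(2) by simp
  let ?z = "z(m := w)"
  have "(\<Sum>i<Suc m. C (?z i)) + (\<integral>\<^sup>+ x. h x * (\<Prod>i<Suc m. W x (?z i)) \<partial>M) = (\<Sum>i<m. C (z i)) + F w"
    by (simp add: F_def H_def mult_ac add_ac)
  also have "\<dots> \<le> (\<integral>\<^sup>+ z. C z \<partial>M) + ((\<Sum>i<m. C (z i)) + (\<integral>\<^sup>+ x. h x * ?u x * (\<Prod>i<m. W x (z i)) \<partial>M))"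
    using Fw by (metis (no_types, lifting) add.left_commute add_left_mono)
  also have "\<dots> \<le> (\<integral>\<^sup>+ z. C z \<partial>M) + (of_nat m * (\<integral>\<^sup>+ z. C z \<partial>M) + (\<integral>\<^sup>+ x. h x * ?u x * ?u x ^ m \<partial>M))"
    by (intro add_left_mono z)
  also have "\<dots> = of_nat (Suc m) * (\<integral>\<^sup>+ z. C z \<partial>M) + (\<integral>\<^sup>+ x. h x * ?u x ^ Suc m \<partial>M)"
    by (simp add: algebra_simps)
  finally have "(\<Sum>i<Suc m. C (?z i)) + (\<integral>\<^sup>+ x. h x * (\<Prod>i<Suc m. W x (?z i)) \<partial>M)
    \<le> of_nat (Suc m) * (\<integral>\<^sup>+ z. C z \<partial>M) + (\<integral>\<^sup>+ x. h x * ?u x ^ Suc m \<partial>M)" .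
  moreover have "\<forall>i. ?z i \<in> space M" using zs w by auto
  ultimately show ?case by blast
qed

text \<open>\<open>(1 - d) ^ m\<close> is the smallest term of the geometric sum over
  \<open>i < m + 1\<close>, and \<open>d\<close> times that sum is
  \<open>1 - (1 - d) ^ (m + 1)\<close>.\<close>

lemma mult_power_le_inverse:
  fixes d :: real
  assumes "0 \<le> d" "d \<le> 1"
  shows "d * (1 - d) ^ m \<le> 1 / (real m + 1)"
proof -
  have "(real m + 1) * (d * (1 - d) ^ m) = d * (\<Sum>i<Suc m. (1 - d) ^ m)" by (simp add: algebra_simps)
  also have "\<dots> \<le> d * (\<Sum>i<Suc m. (1 - d) ^ i)"
    using assms by (intro mult_left_mono sum_mono power_decreasing) auto
  also have "\<dots> = 1 - (1 - d) ^ Suc m"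
    using one_diff_power_eq[of "1 - d" "Suc m"] by simp
  also have "\<dots> \<le> 1" using assms by simp
  finally show ?thesis by (simp add: field_simps)
qed

section \<open>Partitions around centers\<close>

text \<open>Applied to a symmetric relation between three points, this singles out the triples on
  which transitivity fails.\<close>

definition exactly_two :: "bool \<Rightarrow> bool \<Rightarrow> bool \<Rightarrow> bool" where
  "exactly_two a b c \<longleftrightarrow> (a \<and> b \<and> \<not> c) \<or> (a \<and> \<not> b \<and> c) \<or> (\<not> a \<and> b \<and> c)"

text \<open>The label \<open>m\<close> marks points that are related to none of the centers.\<close>

definition label :: "nat \<Rightarrow> ('a \<Rightarrow> 'a \<Rightarrow> bool) \<Rightarrow> (nat \<Rightarrow> 'a) \<Rightarrow> 'a \<Rightarrow> nat" where
  "label m E z x = (LEAST i. i = m \<or> (i < m \<and> E x (z i)))"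

text \<open>The condition \<open>label m E z x < m\<close> separates the points missed by all
  centers from everything, even from themselves: they must not form a class of their own, as nothing
  makes them related to one another.\<close>

definition same_label :: "nat \<Rightarrow> ('a \<Rightarrow> 'a \<Rightarrow> bool) \<Rightarrow> (nat \<Rightarrow> 'a) \<Rightarrow> 'a \<Rightarrow> 'a \<Rightarrow> bool" where
  "same_label m E z x y \<longleftrightarrow> label m E z x = label m E z y \<and> label m E z x < m"

lemma label_le: "label m E z x \<le> m"
  unfolding label_def by (rule Least_le) simp

lemma label_cases: "label m E z x = m \<or> (label m E z x < m \<and> E x (z (label m E z x)))"
  unfolding label_def by (rule LeastI[of _ m]) simp

lemma not_rel_center: "i < label m E z x \<Longrightarrow> \<not> E x (z i)"
  using not_less_Least[of i] label_le[of m E z x] unfolding label_def by fastforce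

lemma label_eqD: "label m E z x = m \<Longrightarrow> i < m \<Longrightarrow> \<not> E x (z i)"
  using not_rel_center[of i m E z x] by simp

text \<open>If the labels differ, the center with the smaller one is related to exactly one of the
  two points; if they agree below \<open>m\<close>, that center is related to both. Either way a
  wrong verdict on the pair makes a bad triple. If both labels are \<open>m\<close>, a wrong verdict
  means that \<open>E x y\<close> holds although \<open>x\<close> is missed.\<close>

lemma disagreement_le:
  assumes "E x y \<noteq> same_label m E z x y"
  shows "(\<exists>i<m. exactly_two (E x y) (E x (z i)) (E y (z i))) \<or> (E x y \<and> (\<forall>i<m. \<not> E x (z i)))"
proof -
  let ?c = "label m E z"
  consider "?c x < ?c y" | "?c y < ?c x" | "?c x = ?c y" "?c x < m" | "?c x = m" "?c y = m"
    using label_le[of m E z x] label_le[of m E z y] by linarith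
  then show ?thesis
  proof cases
    case 1
    then show ?thesis
      using assms label_cases[of m E z x] label_le[of m E z y] not_rel_center[OF 1]
      by (auto simp: same_label_def exactly_two_def)
  next
    case 2
    then show ?thesis
      using assms label_cases[of m E z y] label_le[of m E z x] not_rel_center[OF 2]
      by (intro disjI1 exI[of _ "?c y"]) (auto simp: same_label_def exactly_two_def)
  next
    case 3
    then show ?thesis
      using assms label_cases[of m E z x] label_cases[of m E z y]
      by (auto simp: same_label_def exactly_two_def)
  next
    case 4
    then show ?thesis
      using assms label_eqD[of m E z x] by (auto simp: same_label_def)
  qed
qed

lemma (in prob_space) ex_near_partition:
  assumes E [measurable]: "Measurable.pred (M \<Otimes>\<^sub>M M) (case_prod E)"
  shows "\<exists>z :: nat \<Rightarrow> 'a. (\<forall>i. z i \<in> space M) \<and>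
    (\<integral>\<^sup>+ x. \<integral>\<^sup>+ y. of_bool (E x y \<noteq> same_label m E z x y) \<partial>M \<partial>M)
      \<le> of_nat m * (\<integral>\<^sup>+ z. \<integral>\<^sup>+ x. \<integral>\<^sup>+ y. of_bool (exactly_two (E x y) (E x z) (E y z)) \<partial>M \<partial>M \<partial>M) + ennreal (1 / (real m + 1))"
proof -
  \<comment> \<open>The two sources of error: \<open>C z\<close> is the mass of pairs completing a
    bad triple with \<open>z\<close>, and \<open>h x\<close> times the product of the
    \<open>W x (z i)\<close> is the mass of the points related to \<open>x\<close>, counted only if
    \<open>x\<close> is missed by all centers.\<close>
  define C :: "'a \<Rightarrow> ennreal" where "C z = (\<integral>\<^sup>+ x. \<integral>\<^sup>+ y. of_bool (exactly_two (E x y) (E x z) (E y z)) \<partial>M \<partial>M)" for z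
  define W :: "'a \<Rightarrow> 'a \<Rightarrow> ennreal" where "W x z = of_bool (\<not> E x z)" for x z
  define h :: "'a \<Rightarrow> ennreal" where "h x = (\<integral>\<^sup>+ y. of_bool (E x y) \<partial>M)" for x
  have [measurable]: "C \<in> borel_measurable M" unfolding C_def exactly_two_def of_bool_def by measurable
  have [measurable]: "h \<in> borel_measurable M" unfolding h_def of_bool_def by measurable
  have [measurable]: "case_prod W \<in> borel_measurable (M \<Otimes>\<^sub>M M)" unfolding W_def of_bool_def by measurable
  obtain z where zs: "\<forall>i. z i \<in> space M" and
    z: "(\<Sum>i<m. C (z i)) + (\<integral>\<^sup>+ x. h x * (\<Prod>i<m. W x (z i)) \<partial>M)
      \<le> of_nat m * (\<integral>\<^sup>+ z. C z \<partial>M) + (\<integral>\<^sup>+ x. h x * (\<integral>\<^sup>+ z. W x z \<partial>M) ^ m \<partial>M)"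
    using ex_centers[of C W h m] by auto
  have [measurable]: "z i \<in> space M" for i using zs by blast
  \<comment> \<open>With \<open>d = prob ?A\<close>, the left side is
    \<open>d * (1 - d) ^ m\<close>.\<close>
  have hW: "h x * (\<integral>\<^sup>+ z. W x z \<partial>M) ^ m \<le> ennreal (1 / (real m + 1))" if x [measurable]: "x \<in> space M" for x
  proof -
    let ?A = "{y \<in> space M. E x y}"
    have A [measurable]: "?A \<in> events" by measurable
    have "h x = (\<integral>\<^sup>+ y. indicator ?A y \<partial>M)" unfolding h_def
      by (intro nn_integral_cong) (auto simp: indicator_def)
    also have "\<dots> = ennreal (prob ?A)" by (simp add: emeasure_eq_measure)
    finally have h: "h x = ennreal (prob ?A)" .
    have "(\<integral>\<^sup>+ z. W x z \<partial>M) = (\<integral>\<^sup>+ y. indicator (space M - ?A) y \<partial>M)" unfolding W_def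
      by (intro nn_integral_cong) (auto simp: indicator_def)
    also have "\<dots> = ennreal (1 - prob ?A)"
      by (subst nn_integral_indicator) (auto simp: emeasure_eq_measure prob_compl)
    finally show ?thesis
      using mult_power_le_inverse[of "prob ?A" m] prob_le_1[of ?A]
      by (simp add: h ennreal_power ennreal_mult'[symmetric] ennreal_leI)
  qed
  \<comment> \<open>Union bound: \<open>disagreement_le\<close> in terms of indicators.\<close>
  have "(\<integral>\<^sup>+ x. \<integral>\<^sup>+ y. of_bool (E x y \<noteq> same_label m E z x y) \<partial>M \<partial>M)
    \<le> (\<integral>\<^sup>+ x. \<integral>\<^sup>+ y. (\<Sum>i<m. of_bool (exactly_two (E x y) (E x (z i)) (E y (z i)))) + of_bool (E x y) * (\<Prod>i<m. W x (z i)) \<partial>M \<partial>M)"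
  proof (intro nn_integral_mono)
    fix x y
    show "of_bool (E x y \<noteq> same_label m E z x y) \<le>
      (\<Sum>i<m. of_bool (exactly_two (E x y) (E x (z i)) (E y (z i)))) + (of_bool (E x y) * (\<Prod>i<m. W x (z i)) :: ennreal)" (is "?l \<le> ?s + ?p")
    proof (cases "E x y \<noteq> same_label m E z x y")
      case True
      from disagreement_le[OF this] show ?thesis
      proof
        assume "\<exists>i<m. exactly_two (E x y) (E x (z i)) (E y (z i))"
        then obtain i where i: "i < m" "exactly_two (E x y) (E x (z i)) (E y (z i))" by blast
        have "(1::ennreal) = of_bool (exactly_two (E x y) (E x (z i)) (E y (z i)))" using i by simp
        also have "\<dots> \<le> ?s" using i by (intro member_le_sum) auto
        also have "\<dots> \<le> ?s + ?p" by simp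
        finally show ?thesis using True by simp
      next
        assume "E x y \<and> (\<forall>i<m. \<not> E x (z i))"
        then have "?p = 1" by (simp add: W_def)
        then show ?thesis using True by simp
      qed
    qed simp
  qed
  also have "\<dots> = (\<Sum>i<m. C (z i)) + (\<integral>\<^sup>+ x. h x * (\<Prod>i<m. W x (z i)) \<partial>M)"
  proof -
    have [measurable]: "(\<lambda>x. W x (z i)) \<in> borel_measurable M" for i by measurable
    have "(\<integral>\<^sup>+ x. \<integral>\<^sup>+ y. (\<Sum>i<m. of_bool (exactly_two (E x y) (E x (z i)) (E y (z i)))) + of_bool (E x y) * (\<Prod>i<m. W x (z i)) \<partial>M \<partial>M)
      = (\<integral>\<^sup>+ x. (\<Sum>i<m. \<integral>\<^sup>+ y. of_bool (exactly_two (E x y) (E x (z i)) (E y (z i))) \<partial>M) + h x * (\<Prod>i<m. W x (z i)) \<partial>M)"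
      unfolding h_def exactly_two_def of_bool_def
      by (intro nn_integral_cong, subst nn_integral_add, measurable)
        (subst nn_integral_sum, measurable, subst nn_integral_multc, auto)
    also have "\<dots> = (\<Sum>i<m. C (z i)) + (\<integral>\<^sup>+ x. h x * (\<Prod>i<m. W x (z i)) \<partial>M)"
      unfolding C_def exactly_two_def of_bool_def
      by (subst nn_integral_add, measurable) (subst nn_integral_sum, auto)
    finally show ?thesis .
  qed
  also note z
  also have "(\<integral>\<^sup>+ x. h x * (\<integral>\<^sup>+ z. W x z \<partial>M) ^ m \<partial>M) \<le> (\<integral>\<^sup>+ x. ennreal (1 / (real m + 1)) \<partial>M)"
    by (intro nn_integral_mono hW)
  finally show ?thesis
    using zs unfolding C_def by (auto simp: emeasure_space_1 intro!: exI[of _ z] add_left_mono elim!: order_trans)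
qed

section \<open>Sparse windows and bad triples\<close>

text \<open>Pigeonhole: the \<open>N\<close> adjacent windows of width \<open>e\<close> above
  \<open>a\<close> are disjoint, so the lightest one has mass at most \<open>1 / N\<close>;
  \<open>t\<close> is its upper end.\<close>

lemma (in prob_space) ex_sparse_window:
  fixes g :: "'a \<Rightarrow> 'a \<Rightarrow> real"
  assumes g [measurable]: "case_prod g \<in> borel_measurable (M \<Otimes>\<^sub>M M)"
    and N: "N \<ge> 1" and e: "e > 0"
  shows "\<exists>t. a < t \<and> t \<le> a + real N * e \<and>
    (\<integral>\<^sup>+ x. \<integral>\<^sup>+ y. of_bool (t - e \<le> g x y \<and> g x y < t) \<partial>M \<partial>M) \<le> ennreal (1 / real N)"
proof -
  define w where "w l x y \<longleftrightarrow> a + real l * e \<le> g x y \<and> g x y < a + real (Suc l) * e" for l x y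
  define I :: "nat \<Rightarrow> ennreal" where "I l = (\<integral>\<^sup>+ x. \<integral>\<^sup>+ y. of_bool (w l x y) \<partial>M \<partial>M)" for l
  have [measurable]: "Measurable.pred (M \<Otimes>\<^sub>M M) (case_prod (w l))" for l
    unfolding w_def by measurable
  have disj: "l = l'" if "w l x y" "w l' x y" for l l' x y
  proof (rule ccontr)
    assume "l \<noteq> l'"
    then consider "real (Suc l) \<le> real l'" | "real (Suc l') \<le> real l" by linarith
    then show False
    proof cases
      case 1
      then have "real (Suc l) * e \<le> real l' * e" using e by simp
      then show False using that by (simp add: w_def)
    next
      case 2
      then have "real (Suc l') * e \<le> real l * e" using e by simp
      then show False using that by (simp add: w_def)
    qed
  qed
  have "(\<Sum>l<N. I l) = (\<integral>\<^sup>+ x. \<integral>\<^sup>+ y. (\<Sum>l<N. of_bool (w l x y)) \<partial>M \<partial>M)"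
  proof -
    have "(\<integral>\<^sup>+ x. \<integral>\<^sup>+ y. (\<Sum>l<N. of_bool (w l x y)) \<partial>M \<partial>M) =
      (\<integral>\<^sup>+ x. (\<Sum>l<N. \<integral>\<^sup>+ y. of_bool (w l x y) \<partial>M) \<partial>M)"
      unfolding of_bool_def by (intro nn_integral_cong nn_integral_sum) measurable
    also have "\<dots> = (\<Sum>l<N. I l)"
      unfolding I_def of_bool_def by (intro nn_integral_sum) measurable
    finally show ?thesis by simp
  qed
  also have "\<dots> \<le> (\<integral>\<^sup>+ x. \<integral>\<^sup>+ y. 1 \<partial>M \<partial>M)"
  proof (intro nn_integral_mono)
    fix x y
    show "(\<Sum>l<N. of_bool (w l x y)) \<le> (1 :: ennreal)"
    proof (cases "\<exists>l<N. w l x y")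
      case True
      then obtain l where l: "l < N" "w l x y" by blast
      have "(\<Sum>l'<N. of_bool (w l' x y)) = (\<Sum>l'<N. if l' = l then 1 else (0::ennreal))"
        by (intro sum.cong) (use l disj in auto)
      then show ?thesis using l by simp
    qed auto
  qed
  also have "\<dots> = 1" by (simp add: emeasure_space_1)
  finally have total: "(\<Sum>l<N. I l) \<le> 1" .
  have "\<exists>l<N. I l \<le> ennreal (1 / real N)"
  proof -
    obtain l where l: "l \<in> {..<N}" "\<forall>l'\<in>{..<N}. I l \<le> I l'"
      using finite_has_minimal[of "I ` {..<N}"] N
      by (metis (no_types, lifting) finite_imageI finite_lessThan ex_min_if_finite imageE image_eqI image_is_empty
          lessThan_empty_iff linorder_not_less not_one_le_zero)
    have "of_nat (card {..<N}) * I l \<le> (\<Sum>l<N. I l)"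
      by (rule sum_bounded_below) (use l in auto)
    then have le: "of_nat N * I l \<le> 1" using total by simp
    have "I l \<le> ennreal (1 / real N)"
    proof (cases "I l")
      case (real x)
      then have "ennreal (real N * x) \<le> ennreal 1"
        using le by (simp add: ennreal_of_nat_eq_real_of_nat ennreal_mult)
      then show ?thesis using N real by (simp add: field_simps)
    next
      case top
      then show ?thesis using le N by (simp add: ennreal_mult_top top_unique)
    qed
    with l show ?thesis by auto
  qed
  then obtain l where l: "l < N" "I l \<le> ennreal (1 / real N)" by blast
  define t where "t = a + real (Suc l) * e"
  have "real (Suc l) * e \<le> real N * e" using l e by (intro mult_right_mono) auto
  moreover have te: "t - e = a + real l * e" by (simp add: t_def algebra_simps)
  moreover have "a < t" using e by (simp add: t_def add_pos_nonneg)
  moreover have "I l = (\<integral>\<^sup>+ x. \<integral>\<^sup>+ y. of_bool (t - e \<le> g x y \<and> g x y < t) \<partial>M \<partial>M)"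
    unfolding I_def w_def te unfolding t_def ..
  ultimately show ?thesis using l(2) by (intro exI[of _ t]) (simp add: t_def)
qed

text \<open>If exactly two of the three values reach \<open>t\<close>, the third lies either in the
  window \<open>[t - e, t)\<close> or more than \<open>e\<close> below the other two, which violates
  ultrametricity. Each of the three values can be the low one, hence the two factors 3.\<close>

lemma (in prob_space) nn_integral_exactly_two_le:
  fixes g :: "'a \<Rightarrow> 'a \<Rightarrow> real"
  assumes g [measurable]: "case_prod g \<in> borel_measurable (M \<Otimes>\<^sub>M M)"
    and sym: "\<And>x y. g x y = g y x"
    and viol: "(\<integral>\<^sup>+ x. \<integral>\<^sup>+ y. \<integral>\<^sup>+ z. of_bool (g x y < min (g x z) (g y z) - e) \<partial>M \<partial>M \<partial>M) \<le> c"
    and near: "(\<integral>\<^sup>+ x. \<integral>\<^sup>+ y. of_bool (t - e \<le> g x y \<and> g x y < t) \<partial>M \<partial>M) \<le> d"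
  shows "(\<integral>\<^sup>+ z. \<integral>\<^sup>+ x. \<integral>\<^sup>+ y. of_bool (exactly_two (t \<le> g x y) (t \<le> g x z) (t \<le> g y z)) \<partial>M \<partial>M \<partial>M) \<le> 3 * c + 3 * d"
proof -
  define v :: "'a \<Rightarrow> 'a \<Rightarrow> 'a \<Rightarrow> ennreal" where "v x y z = of_bool (g x y < min (g x z) (g y z) - e)" for x y z
  define b :: "'a \<Rightarrow> 'a \<Rightarrow> ennreal" where "b x y = of_bool (t - e \<le> g x y \<and> g x y < t)" for x y
  \<comment> \<open>Stated for arbitrary arguments, so that \<open>measurable\<close> copes with
    every order of the variables below.\<close>
  have [measurable]: "(\<lambda>x. v (p x) (q x) (r x)) \<in> borel_measurable N"
    if [measurable]: "p \<in> N \<rightarrow>\<^sub>M M" "q \<in> N \<rightarrow>\<^sub>M M" "r \<in> N \<rightarrow>\<^sub>M M" for p q r and N :: "'c measure"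
    unfolding v_def of_bool_def by measurable
  have [measurable]: "case_prod b \<in> borel_measurable (M \<Otimes>\<^sub>M M)"
    unfolding b_def of_bool_def by measurable
  have v_le: "(\<integral>\<^sup>+ x. \<integral>\<^sup>+ y. \<integral>\<^sup>+ z. v x y z \<partial>M \<partial>M \<partial>M) \<le> c" using viol unfolding v_def .
  have b_le: "(\<integral>\<^sup>+ x. \<integral>\<^sup>+ y. b x y \<partial>M \<partial>M) \<le> d" using near unfolding b_def .
  have *: "of_bool (exactly_two (t \<le> g x y) (t \<le> g x z) (t \<le> g y z)) \<le> (v x y z + v z x y + v z y x) + (b x y + b z x + b z y)"
    for x y z
    using sym[of x z] sym[of y z] sym[of x y] unfolding exactly_two_def v_def b_def by (auto simp: min_def)
  have v1: "(\<integral>\<^sup>+ z. \<integral>\<^sup>+ x. \<integral>\<^sup>+ y. v x y z \<partial>M \<partial>M \<partial>M) = (\<integral>\<^sup>+ x. \<integral>\<^sup>+ y. \<integral>\<^sup>+ z. v x y z \<partial>M \<partial>M \<partial>M)"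
  proof -
    have "(\<integral>\<^sup>+ z. \<integral>\<^sup>+ x. \<integral>\<^sup>+ y. v x y z \<partial>M \<partial>M \<partial>M) = (\<integral>\<^sup>+ x. \<integral>\<^sup>+ z. \<integral>\<^sup>+ y. v x y z \<partial>M \<partial>M \<partial>M)"
      by (rule nn_integral_swap) measurable
    also have "\<dots> = (\<integral>\<^sup>+ x. \<integral>\<^sup>+ y. \<integral>\<^sup>+ z. v x y z \<partial>M \<partial>M \<partial>M)"
      by (intro nn_integral_cong nn_integral_swap) measurable
    finally show ?thesis .
  qed
  have v2: "(\<integral>\<^sup>+ z. \<integral>\<^sup>+ x. \<integral>\<^sup>+ y. v z y x \<partial>M \<partial>M \<partial>M) = (\<integral>\<^sup>+ z. \<integral>\<^sup>+ x. \<integral>\<^sup>+ y. v z x y \<partial>M \<partial>M \<partial>M)"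
    by (intro nn_integral_cong nn_integral_swap) measurable
  have b1: "(\<integral>\<^sup>+ z. \<integral>\<^sup>+ x. \<integral>\<^sup>+ y. b x y \<partial>M \<partial>M \<partial>M) = (\<integral>\<^sup>+ x. \<integral>\<^sup>+ y. b x y \<partial>M \<partial>M)"
    and b2: "(\<integral>\<^sup>+ z. \<integral>\<^sup>+ x. \<integral>\<^sup>+ y. b z x \<partial>M \<partial>M \<partial>M) = (\<integral>\<^sup>+ x. \<integral>\<^sup>+ y. b x y \<partial>M \<partial>M)"
    and b3: "(\<integral>\<^sup>+ z. \<integral>\<^sup>+ x. \<integral>\<^sup>+ y. b z y \<partial>M \<partial>M \<partial>M) = (\<integral>\<^sup>+ x. \<integral>\<^sup>+ y. b x y \<partial>M \<partial>M)"
    by (simp_all add: emeasure_space_1)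
  have "(\<integral>\<^sup>+ z. \<integral>\<^sup>+ x. \<integral>\<^sup>+ y. of_bool (exactly_two (t \<le> g x y) (t \<le> g x z) (t \<le> g y z)) \<partial>M \<partial>M \<partial>M)
    \<le> (\<integral>\<^sup>+ z. \<integral>\<^sup>+ x. \<integral>\<^sup>+ y. (v x y z + v z x y + v z y x) + (b x y + b z x + b z y) \<partial>M \<partial>M \<partial>M)"
    by (intro nn_integral_mono *)
  also have "\<dots> = ((\<integral>\<^sup>+ z. \<integral>\<^sup>+ x. \<integral>\<^sup>+ y. v x y z \<partial>M \<partial>M \<partial>M)
      + (\<integral>\<^sup>+ z. \<integral>\<^sup>+ x. \<integral>\<^sup>+ y. v z x y \<partial>M \<partial>M \<partial>M) + (\<integral>\<^sup>+ z. \<integral>\<^sup>+ x. \<integral>\<^sup>+ y. v z y x \<partial>M \<partial>M \<partial>M))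
      + ((\<integral>\<^sup>+ z. \<integral>\<^sup>+ x. \<integral>\<^sup>+ y. b x y \<partial>M \<partial>M \<partial>M) + (\<integral>\<^sup>+ z. \<integral>\<^sup>+ x. \<integral>\<^sup>+ y. b z x \<partial>M \<partial>M \<partial>M)
      + (\<integral>\<^sup>+ z. \<integral>\<^sup>+ x. \<integral>\<^sup>+ y. b z y \<partial>M \<partial>M \<partial>M))"
    (is "?I = _")
  proof -
    have "?I = (\<integral>\<^sup>+ z. \<integral>\<^sup>+ x. ((\<integral>\<^sup>+ y. v x y z \<partial>M) + (\<integral>\<^sup>+ y. v z x y \<partial>M) + (\<integral>\<^sup>+ y. v z y x \<partial>M))
      + ((\<integral>\<^sup>+ y. b x y \<partial>M) + (\<integral>\<^sup>+ y. b z x \<partial>M) + (\<integral>\<^sup>+ y. b z y \<partial>M)) \<partial>M \<partial>M)"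
      by (intro nn_integral_cong) (subst nn_integral_add; simp)+
    also have "\<dots> = (\<integral>\<^sup>+ z. ((\<integral>\<^sup>+ x. \<integral>\<^sup>+ y. v x y z \<partial>M \<partial>M) + (\<integral>\<^sup>+ x. \<integral>\<^sup>+ y. v z x y \<partial>M \<partial>M) + (\<integral>\<^sup>+ x. \<integral>\<^sup>+ y. v z y x \<partial>M \<partial>M))
      + ((\<integral>\<^sup>+ x. \<integral>\<^sup>+ y. b x y \<partial>M \<partial>M) + (\<integral>\<^sup>+ x. \<integral>\<^sup>+ y. b z x \<partial>M \<partial>M) + (\<integral>\<^sup>+ x. \<integral>\<^sup>+ y. b z y \<partial>M \<partial>M)) \<partial>M)"
      by (intro nn_integral_cong) (subst nn_integral_add; simp)+
    also have "\<dots> = ((\<integral>\<^sup>+ z. \<integral>\<^sup>+ x. \<integral>\<^sup>+ y. v x y z \<partial>M \<partial>M \<partial>M)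
      + (\<integral>\<^sup>+ z. \<integral>\<^sup>+ x. \<integral>\<^sup>+ y. v z x y \<partial>M \<partial>M \<partial>M) + (\<integral>\<^sup>+ z. \<integral>\<^sup>+ x. \<integral>\<^sup>+ y. v z y x \<partial>M \<partial>M \<partial>M))
      + ((\<integral>\<^sup>+ z. \<integral>\<^sup>+ x. \<integral>\<^sup>+ y. b x y \<partial>M \<partial>M \<partial>M) + (\<integral>\<^sup>+ z. \<integral>\<^sup>+ x. \<integral>\<^sup>+ y. b z x \<partial>M \<partial>M \<partial>M)
      + (\<integral>\<^sup>+ z. \<integral>\<^sup>+ x. \<integral>\<^sup>+ y. b z y \<partial>M \<partial>M \<partial>M))"
      by (subst nn_integral_add; simp)+
    finally show ?thesis .
  qed
  also have "\<dots> \<le> (c + c + c) + (d + d + d)"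
    unfolding v1 v2 b1 b2 b3 by (intro add_mono v_le b_le)
  also have "\<dots> = 3 * c + 3 * d"
  proof -
    have "x + x + x = (1 + 1 + 1) * x" for x :: ennreal by (simp only: distrib_right mult_1_left)
    then show ?thesis by simp
  qed
  finally show ?thesis .
qed

section \<open>Label lists and their common prefixes\<close>

lemma measurable_label [measurable]:
  assumes E [measurable]: "Measurable.pred (M \<Otimes>\<^sub>M M) (case_prod E)"
    and z [measurable]: "\<And>i. z i \<in> space M"
  shows "label m E z \<in> measurable M (count_space UNIV)"
  unfolding label_def by measurable

text \<open>Intended for labels \<open>c j\<close>, \<open>c' j\<close> at level \<open>j\<close>,
  where \<open>P\<close> says that a label belongs to a center. Cutting the lists at the first label
  outside \<open>P\<close> matters: two points missed at the same level carry equal labels but count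
  as separated, so the common prefix has to stop there. Its length is then the first level at which
  \<open>e\<close> fails, or \<open>k\<close>.\<close>

lemma longest_common_prefix_takeWhile:
  assumes "\<And>j. j < k \<Longrightarrow> e j \<longleftrightarrow> c j = c' j \<and> P (c j)"
  defines "d \<equiv> length (longest_common_prefix (takeWhile P (map c [0..<k])) (takeWhile P (map c' [0..<k])))"
  shows "d \<le> k" "\<And>j. j < d \<Longrightarrow> e j" "d < k \<Longrightarrow> \<not> e d"
proof -
  let ?L = "takeWhile P (map c [0..<k])" and ?L' = "takeWhile P (map c' [0..<k])"
  let ?l = "longest_common_prefix ?L ?L'"
  have p: "prefix ?l ?L" "prefix ?l ?L'"
    using longest_common_prefix_prefix1 longest_common_prefix_prefix2 by blast+
  have len: "length ?L \<le> k" "length ?L' \<le> k"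
    using length_takeWhile_le[of P "map c [0..<k]"] length_takeWhile_le[of P "map c' [0..<k]"] by auto
  have d: "d = length ?l" by (simp add: d_def)
  have dl: "d \<le> length ?L" "d \<le> length ?L'" using p prefix_length_le unfolding d by blast+
  show "d \<le> k" using dl len by linarith
  have nthL: "?L ! j = c j \<and> P (c j)" if "j < length ?L" for j
    using that len takeWhile_nth[OF that] set_takeWhileD[OF nth_mem[OF that]] by auto
  have nthL': "?L' ! j = c' j \<and> P (c' j)" if "j < length ?L'" for j
    using that len takeWhile_nth[OF that] set_takeWhileD[OF nth_mem[OF that]] by auto
  show "e j" if j: "j < d" for j
  proof -
    have "?l ! j = ?L ! j" "?l ! j = ?L' ! j"
      using p j unfolding d by (metis nth_append prefixE)+
    then show ?thesis using assms(1)[of j] nthL[of j] nthL'[of j] j dl len by auto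
  qed
  show "\<not> e d" if dk: "d < k"
  proof
    assume "e d"
    with assms(1) dk have cd: "c d = c' d" "P (c d)" by auto
    have lt: "d < length (takeWhile P (map f [0..<k]))"
      if "d \<le> length (takeWhile P (map f [0..<k]))" "P (f d)" for f
    proof (rule ccontr)
      assume "\<not> ?thesis"
      then have "length (takeWhile P (map f [0..<k])) = d" using that by simp
      then have "\<not> P (map f [0..<k] ! d)"
        using nth_length_takeWhile[of P "map f [0..<k]"] dk by simp
      then show False using that dk by simp
    qed
    have lts: "d < length ?L" "d < length ?L'" using lt[OF dl(1)] lt[OF dl(2)] cd by auto
    \<comment> \<open>Both lists continue with the same entry, so the common prefix could be
      extended.\<close>
    have "take d ?L = ?l" "take d ?L' = ?l" using p unfolding d by (metis append_eq_conv_conj prefixE)+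
    then have "prefix (?l @ [c d]) ?L" "prefix (?l @ [c d]) ?L'"
      using lts nthL nthL' cd(1) by (metis take_Suc_conv_app_nth take_is_prefix)+
    then have "prefix (?l @ [c d]) ?l" by (rule longest_common_prefix_max_prefix)
    then show False by (auto dest: prefix_length_le)
  qed
qed

section \<open>Approximately ultrametric kernels\<close>

text \<open>The window is chosen as sparse as the violations are rare, both of mass at most
  \<open>1 / N\<close>; a center then costs \<open>3 / N + 3 / N\<close>.\<close>

lemma (in prob_space) ex_level:
  fixes g :: "'a \<Rightarrow> 'a \<Rightarrow> real"
  assumes g [measurable]: "case_prod g \<in> borel_measurable (M \<Otimes>\<^sub>M M)"
    and sym: "\<And>x y. g x y = g y x"
    and N: "N \<ge> 1" and e: "e > 0"
    and viol: "(\<integral>\<^sup>+ x. \<integral>\<^sup>+ y. \<integral>\<^sup>+ z. of_bool (g x y < min (g x z) (g y z) - e) \<partial>M \<partial>M \<partial>M) \<le> ennreal (1 / real N)"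
  shows "\<exists>t z. a < t \<and> t \<le> a + real N * e \<and> (\<forall>i::nat. z i \<in> space M) \<and>
    (\<integral>\<^sup>+ x. \<integral>\<^sup>+ y. of_bool ((t \<le> g x y) \<noteq> same_label m (\<lambda>x y. t \<le> g x y) z x y) \<partial>M \<partial>M)
      \<le> ennreal (6 * real m / real N + 1 / (real m + 1))"
proof -
  obtain t where t: "a < t" "t \<le> a + real N * e"
    "(\<integral>\<^sup>+ x. \<integral>\<^sup>+ y. of_bool (t - e \<le> g x y \<and> g x y < t) \<partial>M \<partial>M) \<le> ennreal (1 / real N)"
    using ex_sparse_window[OF g N e] by blast
  have "Measurable.pred (M \<Otimes>\<^sub>M M) (\<lambda>(x, y). t \<le> g x y)" by measurable
  from ex_near_partition[OF this, of m] obtain z where z: "\<forall>i. z i \<in> space M"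
    "(\<integral>\<^sup>+ x. \<integral>\<^sup>+ y. of_bool ((t \<le> g x y) \<noteq> same_label m (\<lambda>x y. t \<le> g x y) z x y) \<partial>M \<partial>M)
      \<le> of_nat m * (\<integral>\<^sup>+ z. \<integral>\<^sup>+ x. \<integral>\<^sup>+ y. of_bool (exactly_two (t \<le> g x y) (t \<le> g x z) (t \<le> g y z)) \<partial>M \<partial>M \<partial>M) + ennreal (1 / (real m + 1))"
    by blast
  note z(2)
  also have "of_nat m * (\<integral>\<^sup>+ z. \<integral>\<^sup>+ x. \<integral>\<^sup>+ y. of_bool (exactly_two (t \<le> g x y) (t \<le> g x z) (t \<le> g y z)) \<partial>M \<partial>M \<partial>M) + ennreal (1 / (real m + 1))
    \<le> of_nat m * (3 * ennreal (1 / real N) + 3 * ennreal (1 / real N)) + ennreal (1 / (real m + 1))"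
    by (intro add_right_mono mult_left_mono nn_integral_exactly_two_le[OF g sym viol t(3)]) simp
  also have "\<dots> = ennreal (6 * real m / real N + 1 / (real m + 1))"
  proof -
    have "3 * ennreal (1 / real N) = ennreal (3 / real N)"
      using ennreal_mult'[of 3 "1 / real N"] by simp
    then have "3 * ennreal (1 / real N) + 3 * ennreal (1 / real N) = ennreal (3 / real N + 3 / real N)"
      by (simp only:) (simp flip: ennreal_plus)
    also have "3 / real N + 3 / real N = 6 / real N" by simp
    finally have "3 * ennreal (1 / real N) + 3 * ennreal (1 / real N) = ennreal (6 / real N)" .
    then show ?thesis
      by (simp add: ennreal_of_nat_eq_real_of_nat mult.commute flip: ennreal_mult' ennreal_plus)
  qed
  finally show ?thesis using t z(1) by blast
qed

text \<open>If a pair is judged correctly at all \<open>k\<close> levels, a common prefix of length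
  \<open>d\<close> means \<open>t (d - 1) \<le> g x y < t d\<close>, which pins \<open>g x y\<close>
  to within \<open>s\<close> of \<open>q d\<close>; any other pair is charged \<open>2 * B\<close>
  for each wrong level. The majorant \<open>D\<close> adds up these errors in a form whose integral
  is easily bounded.\<close>

lemma (in prob_space) ex_clustering_of_approx_ultrametric:
  fixes g :: "'a \<Rightarrow> 'a \<Rightarrow> real"
  assumes g [measurable]: "case_prod g \<in> borel_measurable (M \<Otimes>\<^sub>M M)"
    and sym: "\<And>x y. g x y = g y x"
    and bound: "\<And>x y. \<bar>g x y\<bar> \<le> B"
    and B: "B > 0" and k: "k \<ge> 1"
    and viol: "(\<integral>\<^sup>+ x. \<integral>\<^sup>+ y. \<integral>\<^sup>+ z. of_bool (g x y < min (g x z) (g y z) - 2 * B / real (k ^ 5)) \<partial>M \<partial>M \<partial>M)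
      \<le> ennreal (1 / real (k ^ 4))"
  shows "\<exists>(L :: 'a \<Rightarrow> nat list) q D. finite (range L) \<and> (\<forall>l. {x \<in> space M. prefix l (L x)} \<in> sets M) \<and>
    case_prod D \<in> borel_measurable (M \<Otimes>\<^sub>M M) \<and>
    (\<forall>x y. ennreal \<bar>g x y - q (length (longest_common_prefix (L x) (L y)))\<bar> \<le> D x y) \<and>
    (\<integral>\<^sup>+ x. \<integral>\<^sup>+ y. D x y \<partial>M \<partial>M) \<le> ennreal (16 * B / real k)"
proof -
  define e where "e = 2 * B / real (k ^ 5)"
  define N where "N = k ^ 4"
  define m where "m = k ^ 2"
  define s where "s = 2 * B / real k"
  have e: "e > 0" and N: "N \<ge> 1" and s: "s > 0" using B k by (auto simp: e_def N_def s_def)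
  \<comment> \<open>The \<open>N\<close> windows of width \<open>e\<close> exactly fill the interval
    reserved for one level.\<close>
  have Ne: "real N * e = s" using k by (simp add: e_def N_def s_def field_simps eval_nat_numeral)
  have ks: "real k * s = 2 * B" using k by (simp add: s_def)
  have viol': "(\<integral>\<^sup>+ x. \<integral>\<^sup>+ y. \<integral>\<^sup>+ z. of_bool (g x y < min (g x z) (g y z) - e) \<partial>M \<partial>M \<partial>M) \<le> ennreal (1 / real N)"
    using viol unfolding e_def N_def .
  let ?p = "\<lambda>t z x y. (t \<le> g x y) \<noteq> same_label m (\<lambda>x y. t \<le> g x y) z x y"
  let ?r = "6 * real m / real N + 1 / (real m + 1)"
  let ?Q = "\<lambda>j (t, z). - B + real j * s < t \<and> t \<le> - B + real j * s + s \<and> (\<forall>i::nat. z i \<in> space M) \<and>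
    (\<integral>\<^sup>+ x. \<integral>\<^sup>+ y. of_bool (?p t z x y) \<partial>M \<partial>M) \<le> ennreal ?r"
  have "\<exists>tz. ?Q j tz" for j :: nat
    using ex_level[OF g sym N e viol', of "- B + real j * s" m] unfolding Ne split_paired_Ex split .
  then have "\<forall>j. \<exists>tz. ?Q j tz" ..
  from choice[OF this] obtain tz where tz: "\<forall>j. ?Q j (tz j)" ..
  define t where "t j = fst (tz j)" for j
  define z where "z j = snd (tz j)" for j
  have tz': "- B + real j * s < t j \<and> t j \<le> - B + real j * s + s \<and> (\<forall>i. z j i \<in> space M) \<and>
    (\<integral>\<^sup>+ x. \<integral>\<^sup>+ y. of_bool (?p (t j) (z j) x y) \<partial>M \<partial>M) \<le> ennreal ?r" for j
    using spec[OF tz, of j] unfolding t_def z_def case_prod_beta .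
  then have t: "\<And>j. - B + real j * s < t j" "\<And>j. t j \<le> - B + real j * s + s"
    and z [measurable]: "\<And>j i. z j i \<in> space M"
    and p: "\<And>j. (\<integral>\<^sup>+ x. \<integral>\<^sup>+ y. of_bool (?p (t j) (z j) x y) \<partial>M \<partial>M) \<le> ennreal ?r"
    by blast+
  define c where "c x j = label m (\<lambda>x y. t j \<le> g x y) (z j) x" for x j
  define L where "L x = takeWhile (\<lambda>i. i < m) (map (c x) [0..<k])" for x
  define q where "q d = - B + real d * s" for d :: nat
  define p' where "p' j x y = ?p (t j) (z j) x y" for j x y
  define D where "D x y = ennreal s + ennreal (2 * B) * (\<Sum>j<k. of_bool (p' j x y))" for x y
  have c [measurable]: "(\<lambda>x. c x j) \<in> measurable M (count_space UNIV)" for j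
    unfolding c_def by (rule measurable_label) measurable
  have c_pair: "Measurable.pred (M \<Otimes>\<^sub>M M) (\<lambda>p. c (fst p) j = i)"
    "Measurable.pred (M \<Otimes>\<^sub>M M) (\<lambda>p. c (snd p) j = i)" for i j
    using measurable_compose[OF measurable_compose[OF measurable_fst c], of "\<lambda>l. l = i" "count_space UNIV"]
      measurable_compose[OF measurable_compose[OF measurable_snd c], of "\<lambda>l. l = i" "count_space UNIV"]
    by simp_all
  have p'_eq: "p' j x y \<longleftrightarrow> (t j \<le> g x y) \<noteq> (c x j = c y j \<and> c x j < m)" for j x y
    by (simp add: p'_def c_def same_label_def)
  have [measurable]: "Measurable.pred (M \<Otimes>\<^sub>M M) (case_prod (p' j))" for j
  proof -
    \<comment> \<open>Equality of two labels is split over the countably many common values, each of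
      which gives a measurable event.\<close>
    have eq: "case_prod (p' j) = (\<lambda>p. (t j \<le> g (fst p) (snd p)) \<noteq>
        (\<exists>i. i < m \<and> c (fst p) j = i \<and> c (snd p) j = i))"
      by (auto simp: p'_eq fun_eq_iff)
    show ?thesis unfolding eq
      by (intro pred_intros_logic pred_intros_countable c_pair) measurable
  qed
  have "L x \<in> {l. set l \<subseteq> {..<m} \<and> length l \<le> k}" for x
    using length_takeWhile_le[of "\<lambda>i. i < m" "map (c x) [0..<k]"]
    by (auto simp: L_def dest: set_takeWhileD)
  then have "finite (range L)"
    by (intro finite_subset[OF _ finite_lists_length_le[of "{..<m}" k]]) auto
  moreover have "{x \<in> space M. prefix l (L x)} \<in> sets M" for l
  proof -
    have "prefix l (L x) \<longleftrightarrow> length l \<le> k \<and> (\<forall>j<length l. l ! j < m \<and> c x j = l ! j)" for x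
    proof
      assume pr: "prefix l (L x)"
      have "prefix (L x) (map (c x) [0..<k])" unfolding L_def by (rule takeWhile_is_prefix)
      with pr have pr': "prefix l (map (c x) [0..<k])" by (rule prefix_order.trans)
      then have le: "length l \<le> k" by (auto dest: prefix_length_le)
      have "l ! j < m \<and> c x j = l ! j" if "j < length l" for j
      proof
        have "l ! j \<in> set (L x)" using pr that set_mono_prefix by fastforce
        then show "l ! j < m" by (auto simp: L_def dest: set_takeWhileD)
        have "l ! j = map (c x) [0..<k] ! j" using pr' that by (metis nth_append prefixE)
        then show "c x j = l ! j" using that le by simp
      qed
      with le show "length l \<le> k \<and> (\<forall>j<length l. l ! j < m \<and> c x j = l ! j)" by blast
    next
      assume *: "length l \<le> k \<and> (\<forall>j<length l. l ! j < m \<and> c x j = l ! j)"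
      then have "map (c x) [0..<k] = l @ map (c x) [length l..<k]"
        by (intro nth_equalityI) (auto simp: nth_append)
      moreover have "\<forall>i\<in>set l. i < m" using * by (auto simp: in_set_conv_nth)
      ultimately have "L x = l @ takeWhile (\<lambda>i. i < m) (map (c x) [length l..<k])"
        unfolding L_def by (simp add: takeWhile_append2)
      then show "prefix l (L x)" by simp
    qed
    then show ?thesis by simp
  qed
  moreover have "case_prod D \<in> borel_measurable (M \<Otimes>\<^sub>M M)"
    unfolding D_def of_bool_def by measurable
  moreover have "ennreal \<bar>g x y - q (length (longest_common_prefix (L x) (L y)))\<bar> \<le> D x y" for x y
  proof -
    let ?d = "length (longest_common_prefix (L x) (L y))"
    have dk: "?d \<le> k"
      unfolding L_def by (rule longest_common_prefix_takeWhile(1)[of k "\<lambda>j. c x j = c y j \<and> c x j < m"]) simp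
    show ?thesis
    proof (cases "\<exists>j<k. p' j x y")
      case False
      then have agree: "t j \<le> g x y \<longleftrightarrow> c x j = c y j \<and> c x j < m" if "j < k" for j
        using that by (auto simp: p'_eq)
      have up: "t j \<le> g x y" if "j < ?d" for j
        using longest_common_prefix_takeWhile(2)[of k "\<lambda>j. t j \<le> g x y" "c x" "c y" "\<lambda>i. i < m"] agree that
        unfolding L_def by blast
      have lo: "\<not> t ?d \<le> g x y" if "?d < k"
        using longest_common_prefix_takeWhile(3)[of k "\<lambda>j. t j \<le> g x y" "c x" "c y" "\<lambda>i. i < m"] agree that
        unfolding L_def by blast
      \<comment> \<open>At depth 0 no level bounds \<open>g x y\<close> from below, and at depth
        \<open>k\<close> none from above; there the bound \<open>B\<close> takes over, as
        \<open>q 0 = - B\<close> and \<open>q k = B\<close>.\<close>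
      have "q ?d - s \<le> g x y"
      proof (cases "?d")
        case 0
        then show ?thesis using bound[of x y] s by (simp add: q_def)
      next
        case (Suc j)
        then have "t j \<le> g x y" using up by simp
        then show ?thesis using t(1)[of j] by (simp add: q_def Suc algebra_simps)
      qed
      moreover have "g x y \<le> q ?d + s"
      proof (cases "?d < k")
        case True
        then show ?thesis using lo t(2)[of ?d] by (simp add: q_def)
      next
        case False
        then have "?d = k" using dk by simp
        then show ?thesis using bound[of x y] s ks by (simp add: q_def)
      qed
      ultimately have "\<bar>g x y - q ?d\<bar> \<le> s" by linarith
      then have "ennreal \<bar>g x y - q ?d\<bar> \<le> ennreal s" by (rule ennreal_leI)
      also have "\<dots> \<le> D x y" unfolding D_def by simp
      finally show ?thesis .
    next
      case True
      then obtain j where j: "j < k" "p' j x y" by blast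
      have "real ?d * s \<le> 2 * B" using mult_right_mono[of "real ?d" "real k" s] dk s ks by simp
      moreover have "0 \<le> real ?d * s" using s by simp
      ultimately have "\<bar>g x y - q ?d\<bar> \<le> 2 * B" using bound[of x y] unfolding q_def by linarith
      then have "ennreal \<bar>g x y - q ?d\<bar> \<le> ennreal (2 * B) * 1" by (simp add: ennreal_leI)
      also have "(1::ennreal) \<le> (\<Sum>j<k. of_bool (p' j x y))"
      proof -
        have "(1::ennreal) = of_bool (p' j x y)" using j by simp
        also have "\<dots> \<le> (\<Sum>j<k. of_bool (p' j x y))" using j by (intro member_le_sum) auto
        finally show ?thesis .
      qed
      also have "ennreal (2 * B) * (\<Sum>j<k. of_bool (p' j x y)) \<le> D x y" unfolding D_def by simp
      finally show ?thesis by (simp add: mult_left_mono)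
    qed
  qed
  moreover have "(\<integral>\<^sup>+ x. \<integral>\<^sup>+ y. D x y \<partial>M \<partial>M) \<le> ennreal (16 * B / real k)"
  proof -
    have "(\<integral>\<^sup>+ x. \<integral>\<^sup>+ y. D x y \<partial>M \<partial>M) = (\<integral>\<^sup>+ x. ennreal s + ennreal (2 * B) * (\<Sum>j<k. \<integral>\<^sup>+ y. of_bool (p' j x y) \<partial>M) \<partial>M)"
      unfolding D_def of_bool_def
      by (intro nn_integral_cong, subst nn_integral_add, measurable, subst nn_integral_cmult, measurable, subst nn_integral_sum)
        (auto simp: emeasure_space_1)
    also have "\<dots> = ennreal s + ennreal (2 * B) * (\<Sum>j<k. \<integral>\<^sup>+ x. \<integral>\<^sup>+ y. of_bool (p' j x y) \<partial>M \<partial>M)"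
      unfolding of_bool_def
      by (subst nn_integral_add, measurable, subst nn_integral_cmult, measurable, subst nn_integral_sum)
        (auto simp: emeasure_space_1)
    also have "\<dots> \<le> ennreal s + ennreal (2 * B) * (\<Sum>j<k. ennreal ?r)"
      using p unfolding p'_def by (intro add_left_mono mult_left_mono sum_mono) auto
    also have "\<dots> = ennreal (s + 2 * B * (real k * ?r))"
      using B s by (simp add: ennreal_of_nat_eq_real_of_nat flip: ennreal_mult' ennreal_mult'' ennreal_plus)
    also have "\<dots> \<le> ennreal (16 * B / real k)"
    proof (rule ennreal_leI)
      \<comment> \<open>Each level contributes at most \<open>7 / k ^ 2\<close>; with
        \<open>k\<close> levels of weight \<open>2 * B\<close> this is \<open>14 * B / k\<close>,
        and the spacing \<open>s\<close> adds \<open>2 * B / k\<close>.\<close>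
      have "1 / (real m + 1) \<le> 1 / real m" using k by (intro frac_le) (auto simp: m_def)
      then have "?r \<le> 6 * real m / real N + 1 / real m" by simp
      also have "\<dots> = 7 / (real k)\<^sup>2" using k by (simp add: m_def N_def field_simps eval_nat_numeral)
      finally have "real k * ?r \<le> real k * (7 / (real k)\<^sup>2)" by (rule mult_left_mono) simp
      also have "\<dots> = 7 / real k" using k by (simp add: power2_eq_square)
      finally have "2 * B * (real k * ?r) \<le> 2 * B * (7 / real k)" using B by (intro mult_left_mono) auto
      then show "s + 2 * B * (real k * ?r) \<le> 16 * B / real k" by (simp add: s_def add_divide_distrib[symmetric])
    qed
    finally show ?thesis .
  qed
  ultimately show ?thesis by blast
qed

section \<open>Spin glasses\<close>

text \<open>Reduces the infinite product in \<open>gibbs_avg\<close> to iterated integrals: the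
  product is pushed forward to the coordinates \<open>{1, 2, 3}\<close>, which are then split off
  one by one.\<close>

lemma (in prob_space) nn_integral_iid_triple:
  assumes [measurable]: "(\<lambda>(x, y, z). \<phi> x y z) \<in> borel_measurable (M \<Otimes>\<^sub>M M \<Otimes>\<^sub>M M)"
  shows "(\<integral>\<^sup>+ s. \<phi> (s 1) (s 2) (s 3) \<partial>PiM {1::nat..} (\<lambda>_. M))
    = (\<integral>\<^sup>+ x. \<integral>\<^sup>+ y. \<integral>\<^sup>+ z. \<phi> x y z \<partial>M \<partial>M \<partial>M)"
proof -
  interpret product_prob_space "\<lambda>_. M" "{1::nat..}" by unfold_locales
  have [measurable]: "(\<lambda>w. \<phi> (p w) (q w) (r w)) \<in> borel_measurable N"
    if [measurable]: "p \<in> N \<rightarrow>\<^sub>M M" "q \<in> N \<rightarrow>\<^sub>M M" "r \<in> N \<rightarrow>\<^sub>M M" for p q r and N :: "'c measure"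
    by (rule measurable_compose[of "\<lambda>w. (p w, q w, r w)" N "M \<Otimes>\<^sub>M M \<Otimes>\<^sub>M M" "\<lambda>(x, y, z). \<phi> x y z", simplified]) measurable
  let ?J = "{1, 2, 3::nat}"
  have "(\<integral>\<^sup>+ s. \<phi> (s 1) (s 2) (s 3) \<partial>PiM ?J (\<lambda>_. M))
    = (\<integral>\<^sup>+ s. \<phi> (s 1) (s 2) (s 3) \<partial>distr (PiM {1::nat..} (\<lambda>_. M)) (PiM ?J (\<lambda>_. M)) (\<lambda>x. restrict x ?J))"
    by (subst distr_PiM_restrict_finite) auto
  also have "\<dots> = (\<integral>\<^sup>+ s. \<phi> (s 1) (s 2) (s 3) \<partial>PiM {1::nat..} (\<lambda>_. M))"
    by (subst nn_integral_distr) (auto intro!: measurable_restrict_subset)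
  finally have "(\<integral>\<^sup>+ s. \<phi> (s 1) (s 2) (s 3) \<partial>PiM {1::nat..} (\<lambda>_. M))
    = (\<integral>\<^sup>+ s. \<phi> (s 1) (s 2) (s 3) \<partial>PiM ?J (\<lambda>_. M))" by simp
  also have "\<dots> = (\<integral>\<^sup>+ x. \<integral>\<^sup>+ s. \<phi> x (s 2) (s 3) \<partial>PiM {2, 3::nat} (\<lambda>_. M) \<partial>M)"
    by (subst product_nn_integral_insert_rev) auto
  also have "\<dots> = (\<integral>\<^sup>+ x. \<integral>\<^sup>+ y. \<integral>\<^sup>+ s. \<phi> x y (s 3) \<partial>PiM {3::nat} (\<lambda>_. M) \<partial>M \<partial>M)"
    by (intro nn_integral_cong, subst product_nn_integral_insert_rev) auto
  also have "\<dots> = (\<integral>\<^sup>+ x. \<integral>\<^sup>+ y. \<integral>\<^sup>+ z. \<phi> x y z \<partial>M \<partial>M \<partial>M)"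
    by (intro nn_integral_cong, subst product_nn_integral_singleton) auto
  finally show ?thesis .
qed

text \<open>\<open>\<kappa> n\<close> is the largest \<open>k \<le> n\<close> whose sequence is
  below \<open>1 / k\<close> at index \<open>n\<close>. Every fixed \<open>K\<close> qualifies from
  some index on, so \<kappa> tends to infinity.\<close>

lemma ex_diagonal_sequence:
  fixes a :: "nat \<Rightarrow> nat \<Rightarrow> real"
  assumes "\<And>k. k \<ge> 1 \<Longrightarrow> a k \<longlonglongrightarrow> 0"
  shows "\<exists>\<kappa> :: nat \<Rightarrow> nat. (\<forall>n. \<kappa> n \<ge> 1) \<and> filterlim \<kappa> at_top sequentially \<and> (\<lambda>n. a (\<kappa> n) n) \<longlonglongrightarrow> 0"
proof -
  \<comment> \<open>The element 1 is a default that makes the maximum exist;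
    \<open>k \<le> n\<close> keeps the set finite.\<close>
  define S where "S n = {1} \<union> {k. k \<ge> 1 \<and> k \<le> n \<and> \<bar>a k n\<bar> < 1 / real k}" for n
  define \<kappa> where "\<kappa> n = Max (S n)" for n
  have fin: "finite (S n)" "S n \<noteq> {}" for n by (auto simp: S_def)
  have in_S: "\<kappa> n \<in> S n" for n unfolding \<kappa>_def using Max_in[OF fin] .
  have large: "eventually (\<lambda>n. K \<le> \<kappa> n) sequentially" for K
  proof (cases "K \<ge> 1")
    case True
    have "eventually (\<lambda>n. \<bar>a K n\<bar> < 1 / real K) sequentially"
      using order_tendstoD(2)[OF tendsto_rabs[OF assms[OF True]], of "1 / real K"] True by simp
    then show ?thesis
      using eventually_ge_at_top[of K]
    proof eventually_elim
      case (elim n)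
      then have "K \<in> S n" using True by (simp add: S_def)
      then show ?case unfolding \<kappa>_def using Max_ge[OF fin(1)] by simp
    qed
  qed auto
  have "(\<lambda>n. a (\<kappa> n) n) \<longlonglongrightarrow> 0"
  proof (rule tendstoI)
    fix e :: real assume "e > 0"
    then obtain K where K: "K > 0" "inverse (real K) < e" using reals_Archimedean[of e] by (metis zero_less_Suc)
    show "eventually (\<lambda>n. dist (a (\<kappa> n) n) 0 < e) sequentially"
      \<comment> \<open>\<open>K + 1 \<ge> 2\<close> excludes the default, for which membership in
        \<open>S n\<close> says nothing about the sequence.\<close>
      using large[of "K + 1"]
    proof eventually_elim
      case (elim n)
      then have "\<bar>a (\<kappa> n) n\<bar> < 1 / real (\<kappa> n)" using in_S[of n] K by (auto simp: S_def)
      also have "\<dots> \<le> 1 / real K" using elim K by (intro divide_left_mono) auto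
      finally show ?case using K by (simp add: inverse_eq_divide)
    qed
  qed
  moreover have "filterlim \<kappa> at_top sequentially" using large by (simp add: filterlim_at_top)
  moreover have "\<kappa> n \<ge> 1" for n using in_S[of n] by (auto simp: S_def)
  ultimately show ?thesis by blast
qed

text \<open>The kernel is integrated out three times, innermost first, with \<omega> carried along
  as a parameter; this is what makes the set of good realizations an event.\<close>

lemma measurable_nn_integral_kernel_triple:
  assumes \<mu>: "\<mu> \<in> P \<rightarrow>\<^sub>M subprob_algebra S"
    and \<phi> [measurable]: "(\<lambda>(x, y, z). \<phi> x y z) \<in> borel_measurable (S \<Otimes>\<^sub>M S \<Otimes>\<^sub>M S)"
  shows "(\<lambda>\<omega>. \<integral>\<^sup>+ x. \<integral>\<^sup>+ y. \<integral>\<^sup>+ z. \<phi> x y z \<partial>\<mu> \<omega> \<partial>\<mu> \<omega> \<partial>\<mu> \<omega>) \<in> borel_measurable P"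
proof -
  have m3: "(\<lambda>p. \<phi> (snd (fst (fst p))) (snd (fst p)) (snd p)) \<in> borel_measurable (((P \<Otimes>\<^sub>M S) \<Otimes>\<^sub>M S) \<Otimes>\<^sub>M S)"
  proof -
    have "(\<lambda>p. (snd (fst (fst p)), snd (fst p), snd p)) \<in> (((P \<Otimes>\<^sub>M S) \<Otimes>\<^sub>M S) \<Otimes>\<^sub>M S) \<rightarrow>\<^sub>M S \<Otimes>\<^sub>M S \<Otimes>\<^sub>M S"
      by measurable
    from measurable_compose[OF this \<phi>] show ?thesis by (simp add: case_prod_beta)
  qed
  have \<mu>1: "(\<lambda>p. \<mu> (fst p)) \<in> (P \<Otimes>\<^sub>M S) \<rightarrow>\<^sub>M subprob_algebra S"
    by (rule measurable_compose[OF measurable_fst \<mu>])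
  have \<mu>2: "(\<lambda>p. \<mu> (fst (fst p))) \<in> ((P \<Otimes>\<^sub>M S) \<Otimes>\<^sub>M S) \<rightarrow>\<^sub>M subprob_algebra S"
    by (rule measurable_compose[OF measurable_fst \<mu>1])
  have m2: "(\<lambda>p. \<integral>\<^sup>+ z. \<phi> (snd (fst p)) (snd p) z \<partial>\<mu> (fst (fst p))) \<in> borel_measurable ((P \<Otimes>\<^sub>M S) \<Otimes>\<^sub>M S)"
    by (rule nn_integral_measurable_subprob_algebra2[OF _ \<mu>2]) (use m3 in \<open>simp add: case_prod_beta\<close>)
  have m1: "(\<lambda>p. \<integral>\<^sup>+ y. \<integral>\<^sup>+ z. \<phi> (snd p) y z \<partial>\<mu> (fst p) \<partial>\<mu> (fst p)) \<in> borel_measurable (P \<Otimes>\<^sub>M S)"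
    by (rule nn_integral_measurable_subprob_algebra2[OF _ \<mu>1]) (use m2 in \<open>simp add: case_prod_beta\<close>)
  show ?thesis
    by (rule nn_integral_measurable_subprob_algebra2[OF _ \<mu>]) (use m1 in \<open>simp add: case_prod_beta\<close>)
qed

section \<open>Overlaps on the two configuration spaces\<close>

lemma config_space_L2_set:
  assumes "S = hypercube n \<or> S = sphere_space n" "\<sigma> \<in> space S"
  shows "L2_set \<sigma> {1..n} = sqrt (real n)"
  using assms(1)
proof
  assume S: "S = hypercube n"
  have "(\<sigma> k)\<^sup>2 = 1" if "k \<in> {1..n}" for k
    using assms(2) that PiE_mem[of \<sigma> "{1..n}" "\<lambda>_. {-1, 1}" k] by (auto simp: S hypercube_def)
  then show ?thesis by (simp add: L2_set_def)
next
  assume "S = sphere_space n"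
  then show ?thesis using assms(2) by (simp add: sphere_space_def space_restrict_space)
qed

lemma measurable_coordinate:
  assumes "S = hypercube n \<or> S = sphere_space n" "k \<in> {1..n}"
  shows "(\<lambda>\<sigma>. \<sigma> k) \<in> borel_measurable S"
  using assms unfolding hypercube_def sphere_space_def
  by (auto intro!: measurable_restrict_space1 measurable_component_singleton)

lemma measurable_overlap:
  assumes "S = hypercube n \<or> S = sphere_space n"
  shows "case_prod (overlap n) \<in> borel_measurable (S \<Otimes>\<^sub>M S)"
proof -
  have "(\<lambda>p. fst p k) \<in> borel_measurable (S \<Otimes>\<^sub>M S)" "(\<lambda>p. snd p k) \<in> borel_measurable (S \<Otimes>\<^sub>M S)"
    if "k \<in> {1..n}" for k
    using measurable_compose[OF measurable_fst measurable_coordinate[OF assms that]]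
      measurable_compose[OF measurable_snd measurable_coordinate[OF assms that]] .
  then show ?thesis unfolding overlap_def case_prod_beta
    by (intro borel_measurable_times borel_measurable_const borel_measurable_sum)
qed

text \<open>Cauchy-Schwarz, both norms being \<open>sqrt n\<close>.\<close>

lemma overlap_bounds:
  assumes "S = hypercube n \<or> S = sphere_space n" "\<sigma> \<in> space S" "\<tau> \<in> space S"
  shows "overlap n \<sigma> \<tau> \<in> {-1..1}"
proof -
  have "\<bar>\<Sum>k\<in>{1..n}. \<sigma> k * \<tau> k\<bar> \<le> (\<Sum>k\<in>{1..n}. \<bar>\<sigma> k\<bar> * \<bar>\<tau> k\<bar>)"
    by (rule order_trans[OF sum_abs]) (simp add: abs_mult)
  also have "\<dots> \<le> L2_set \<sigma> {1..n} * L2_set \<tau> {1..n}" by (rule L2_set_mult_ineq)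
  also have "\<dots> = real n" using config_space_L2_set[OF assms(1,2)] config_space_L2_set[OF assms(1,3)] by (simp only: real_sqrt_mult_self abs_of_nat)
  finally have "\<bar>overlap n \<sigma> \<tau>\<bar> \<le> 1"
    by (cases "n = 0") (auto simp: overlap_def abs_mult field_simps)
  then show ?thesis by auto
qed

lemma overlap_commute: "overlap n \<sigma> \<tau> = overlap n \<tau> \<sigma>"
  by (simp add: overlap_def mult.commute)

section \<open>From the ansatz to a clustering\<close>

definition ultrametric_violation :: "config measure \<Rightarrow> (config \<Rightarrow> config \<Rightarrow> real) \<Rightarrow> real \<Rightarrow> ennreal" where
  "ultrametric_violation G g e =
    (\<integral>\<^sup>+ x. \<integral>\<^sup>+ y. \<integral>\<^sup>+ z. of_bool (g x y < min (g x z) (g y z) - e) \<partial>G \<partial>G \<partial>G)"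

lemma ex_gibbs_clustering:
  assumes G: "prob_space G" and sets_G: "sets G = sets S"
    and g: "case_prod g \<in> borel_measurable (S \<Otimes>\<^sub>M S)"
    and sym: "\<And>x y. g x y = g y x" and bound: "\<And>x y. \<bar>g x y\<bar> \<le> B" and B: "B > 0"
    and g_eq: "\<And>x y. x \<in> space S \<Longrightarrow> y \<in> space S \<Longrightarrow> g x y = f (overlap n x y)"
    and k: "k \<ge> 1"
    and viol: "ultrametric_violation G g (2 * B / real (k ^ 5)) \<le> ennreal (1 / real (k ^ 4))"
  shows "\<exists>V E r. hierarchical_clustering S V E r \<and>
    (\<exists>q :: nat \<Rightarrow> real. gibbs_avg G (\<lambda>s. \<bar>f (overlap n (s 1) (s 2)) -
      q (depth V E r (smallest_cluster V E r (s 1) (s 2)))\<bar>) \<le> 16 * B / real k)"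
proof -
  interpret prob_space G by fact
  have sp: "space G = space S" by (rule sets_eq_imp_space_eq[OF sets_G])
  have g': "case_prod g \<in> borel_measurable (G \<Otimes>\<^sub>M G)"
    using g measurable_cong_sets[OF sets_pair_measure_cong[OF sets_G sets_G] refl] by blast
  obtain L :: "config \<Rightarrow> nat list" and q D where
    fin: "finite (range L)" and meas: "\<forall>l. {x \<in> space G. prefix l (L x)} \<in> sets G"
    and D: "case_prod D \<in> borel_measurable (G \<Otimes>\<^sub>M G)"
    and le_D: "\<forall>x y. ennreal \<bar>g x y - q (length (longest_common_prefix (L x) (L y)))\<bar> \<le> D x y"
    and int_D: "(\<integral>\<^sup>+ x. \<integral>\<^sup>+ y. D x y \<partial>G \<partial>G) \<le> ennreal (16 * B / real k)"
    using ex_clustering_of_approx_ultrametric[OF g' sym bound B k] viol unfolding ultrametric_violation_def by blast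
  have "\<exists>V E r. hierarchical_clustering S V E r \<and>
    (\<forall>\<sigma>\<in>space S. \<forall>\<tau>\<in>space S. depth V E r (smallest_cluster V E r \<sigma> \<tau>) =
      length (longest_common_prefix (L \<sigma>) (L \<tau>)))"
  proof (rule ex_hierarchical_clustering)
    show "space S \<noteq> {}" using not_empty sp by simp
    show "finite (L ` space S)" using fin by (rule finite_subset[rotated]) auto
    show "{\<sigma> \<in> space S. prefix l (L \<sigma>)} \<in> sets S" for l using meas sp sets_G by simp
  qed
  then obtain V E r where hc: "hierarchical_clustering S V E r"
    and depth_eq: "\<And>\<sigma> \<tau>. \<sigma> \<in> space S \<Longrightarrow> \<tau> \<in> space S \<Longrightarrow>
      depth V E r (smallest_cluster V E r \<sigma> \<tau>) = length (longest_common_prefix (L \<sigma>) (L \<tau>))"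
    by blast
  have D3: "(\<lambda>(x, y, z). D x y) \<in> borel_measurable (G \<Otimes>\<^sub>M G \<Otimes>\<^sub>M G)"
    using D by measurable
  have "gibbs_avg G (\<lambda>s. \<bar>f (overlap n (s 1) (s 2)) -
      q (depth V E r (smallest_cluster V E r (s 1) (s 2)))\<bar>) \<le> 16 * B / real k"
    unfolding gibbs_avg_def
  \<comment> \<open>The estimate is made with the nonnegative integral, where the measurable
    majorant \<open>D\<close> takes the place of the distance to \<open>q\<close>.\<close>
  proof (rule integral_real_bounded)
    show "0 \<le> 16 * B / real k" using B by simp
    have "(\<integral>\<^sup>+ s. ennreal \<bar>f (overlap n (s 1) (s 2)) -
        q (depth V E r (smallest_cluster V E r (s 1) (s 2)))\<bar> \<partial>PiM {1::nat..} (\<lambda>_. G))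
      \<le> (\<integral>\<^sup>+ s. D (s 1) (s 2) \<partial>PiM {1::nat..} (\<lambda>_. G))"
    proof (rule nn_integral_mono)
      fix s :: "nat \<Rightarrow> config" assume "s \<in> space (PiM {1::nat..} (\<lambda>_. G))"
      then have "s 1 \<in> space S" "s 2 \<in> space S" by (auto simp: space_PiM sp)
      then show "ennreal \<bar>f (overlap n (s 1) (s 2)) -
        q (depth V E r (smallest_cluster V E r (s 1) (s 2)))\<bar> \<le> D (s 1) (s 2)"
        using le_D by (simp add: depth_eq g_eq[symmetric])
    qed
    also have "\<dots> = (\<integral>\<^sup>+ x. \<integral>\<^sup>+ y. D x y \<partial>G \<partial>G)"
      by (subst nn_integral_iid_triple[OF D3]) (simp add: emeasure_space_1)
    also note int_D
    finally show "(\<integral>\<^sup>+ s. ennreal \<bar>f (overlap n (s 1) (s 2)) -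
        q (depth V E r (smallest_cluster V E r (s 1) (s 2)))\<bar> \<partial>PiM {1::nat..} (\<lambda>_. G))
      \<le> ennreal (16 * B / real k)" .
  qed
  with hc show ?thesis by blast
qed

text \<open>Links the ansatz to the mass of the complementary event. The bound by 1 makes
  \<open>enn2real\<close> harmless.\<close>

lemma gibbs_avg_ultrametric:
  assumes G: "prob_space G" and sets_G: "sets G = sets S"
    and g: "case_prod g \<in> borel_measurable (S \<Otimes>\<^sub>M S)"
    and g_eq: "\<And>x y. x \<in> space S \<Longrightarrow> y \<in> space S \<Longrightarrow> g x y = f (overlap n x y)"
  shows "gibbs_avg G (\<lambda>s. of_bool (f (overlap n (s 1) (s 2)) \<ge>
      min (f (overlap n (s 1) (s 3))) (f (overlap n (s 2) (s 3))) - e))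
    = 1 - enn2real (ultrametric_violation G g e)"
    and "ultrametric_violation G g e \<le> 1"
proof -
  interpret prob_space G by fact
  interpret Q: prob_space "PiM {1::nat..} (\<lambda>_. G)" by (rule prob_space_PiM) (rule G)
  have sp: "space G = space S" by (rule sets_eq_imp_space_eq[OF sets_G])
  have [measurable]: "case_prod g \<in> borel_measurable (G \<Otimes>\<^sub>M G)"
    using g measurable_cong_sets[OF sets_pair_measure_cong[OF sets_G sets_G] refl] by blast
  define v where "v x y z \<longleftrightarrow> g x y < min (g x z) (g y z) - e" for x y z
  have v3: "(\<lambda>(x, y, z). of_bool (v x y z) :: ennreal) \<in> borel_measurable (G \<Otimes>\<^sub>M G \<Otimes>\<^sub>M G)"
    unfolding v_def of_bool_def by measurable
  have vQ [measurable]: "(\<lambda>s. of_bool (v (s 1) (s 2) (s 3)) :: real) \<in> borel_measurable (PiM {1::nat..} (\<lambda>_. G))"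
    unfolding v_def of_bool_def by measurable
  have int: "integrable (PiM {1::nat..} (\<lambda>_. G)) (\<lambda>s. of_bool (v (s 1) (s 2) (s 3)) :: real)"
    by (rule Q.integrable_const_bound[where B = 1, OF _ vQ]) simp
  have V: "ultrametric_violation G g e = (\<integral>\<^sup>+ s. of_bool (v (s 1) (s 2) (s 3)) \<partial>PiM {1::nat..} (\<lambda>_. G))"
    unfolding ultrametric_violation_def nn_integral_iid_triple[OF v3] by (simp add: v_def)
  have "gibbs_avg G (\<lambda>s. of_bool (f (overlap n (s 1) (s 2)) \<ge>
      min (f (overlap n (s 1) (s 3))) (f (overlap n (s 2) (s 3))) - e))
    = (\<integral>s. 1 - of_bool (v (s 1) (s 2) (s 3)) \<partial>PiM {1::nat..} (\<lambda>_. G))"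
    unfolding gibbs_avg_def
  proof (rule Bochner_Integration.integral_cong[OF refl])
    fix s :: "nat \<Rightarrow> config" assume "s \<in> space (PiM {1::nat..} (\<lambda>_. G))"
    then have "s 1 \<in> space S" "s 2 \<in> space S" "s 3 \<in> space S" by (auto simp: space_PiM sp)
    then show "of_bool (f (overlap n (s 1) (s 2)) \<ge>
        min (f (overlap n (s 1) (s 3))) (f (overlap n (s 2) (s 3))) - e) = (1 - of_bool (v (s 1) (s 2) (s 3)) :: real)"
      by (simp add: v_def g_eq not_less)
  qed
  also have "\<dots> = 1 - (\<integral>s. of_bool (v (s 1) (s 2) (s 3)) \<partial>PiM {1::nat..} (\<lambda>_. G))"
    by (subst Bochner_Integration.integral_diff[OF Q.integrable_const int]) (simp_all add: Q.prob_space[unfolded One_nat_def])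
  also have "(\<integral>s. of_bool (v (s 1) (s 2) (s 3)) \<partial>PiM {1::nat..} (\<lambda>_. G)) = enn2real (ultrametric_violation G g e)"
    unfolding V by (subst integral_eq_nn_integral[OF vQ]) (auto intro!: arg_cong[where f = enn2real] nn_integral_cong)
  finally show "gibbs_avg G (\<lambda>s. of_bool (f (overlap n (s 1) (s 2)) \<ge>
      min (f (overlap n (s 1) (s 3))) (f (overlap n (s 2) (s 3))) - e))
    = 1 - enn2real (ultrametric_violation G g e)" .
  have "ultrametric_violation G g e \<le> (\<integral>\<^sup>+ s. 1 \<partial>PiM {1::nat..} (\<lambda>_. G))"
    unfolding V by (intro nn_integral_mono) auto
  then show "ultrametric_violation G g e \<le> 1" by (simp add: Q.emeasure_space_1[unfolded One_nat_def])
qed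

theorem theorem3p1:
  fixes \<Sigma> :: "nat \<Rightarrow> config measure"
    and P :: "nat \<Rightarrow> 'w measure"
    and \<mu> :: "nat \<Rightarrow> 'w \<Rightarrow> config measure"
    and f :: "real \<Rightarrow> real"
  assumes "spin_glass_models \<Sigma> P \<mu>"
    and "f \<in> borel_measurable (restrict_space borel {-1..1})"
    and "bounded (f ` {-1..1})"
    and "generalized_parisi_ansatz P \<mu> f"
  shows "\<exists>\<epsilon> \<delta> :: nat \<Rightarrow> real. \<epsilon> \<longlonglongrightarrow> 0 \<and> \<delta> \<longlonglongrightarrow> 0 \<and>
    (\<forall>n\<ge>1. \<exists>A\<in>sets (P n). measure (P n) A \<ge> 1 - \<epsilon> n \<and>
      (\<forall>\<omega>\<in>A. \<exists>V E r. hierarchical_clustering (\<Sigma> n) V E r \<and>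
        (\<exists>q :: nat \<Rightarrow> real.
          gibbs_avg (\<mu> n \<omega>)
            (\<lambda>s. \<bar>f (overlap n (s 1) (s 2)) -
                   q (depth V E r (smallest_cluster V E r (s 1) (s 2)))\<bar>) \<le> \<delta> n)))"
proof -
  have S: "\<Sigma> n = hypercube n \<or> \<Sigma> n = sphere_space n"
    and P: "prob_space (P n)" and \<mu>: "\<mu> n \<in> P n \<rightarrow>\<^sub>M prob_algebra (\<Sigma> n)" if "n \<ge> 1" for n
    using assms(1) that by (auto simp: spin_glass_models_def)
  have G: "prob_space (\<mu> n \<omega>)" "sets (\<mu> n \<omega>) = sets (\<Sigma> n)" if "n \<ge> 1" "\<omega> \<in> space (P n)" for n \<omega>
    using measurable_space[OF \<mu>[OF that(1)] that(2)] by (auto simp: space_prob_algebra)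
  \<comment> \<open>Outside \<open>[-1, 1]\<close> nothing is known about \<open>f\<close>. Clamping
    the argument gives a Borel function bounded everywhere, and it changes nothing at overlaps of
    configurations.\<close>
  define F where "F x = f (max (-1) (min 1 x))" for x
  have F_meas: "F \<in> borel_measurable borel"
  proof -
    have "(\<lambda>x::real. max (-1) (min 1 x)) \<in> borel \<rightarrow>\<^sub>M restrict_space borel {-1..1}"
      by (intro measurable_restrict_space2) auto
    from measurable_compose[OF this assms(2)] show ?thesis unfolding F_def .
  qed
  obtain B where B: "B > 0" and F_bound: "\<And>x. \<bar>F x\<bar> \<le> B"
  proof -
    obtain b where "\<forall>y\<in>f ` {-1..1}. \<bar>y\<bar> \<le> b" using assms(3) by (auto simp: bounded_real)
    then have "\<bar>F x\<bar> \<le> max b 1" for x by (auto simp: F_def le_max_iff_disj)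
    then show ?thesis using that[of "max b 1"] by auto
  qed
  define g where "g n x y = F (overlap n x y)" for n x y
  have g_meas: "case_prod (g n) \<in> borel_measurable (\<Sigma> n \<Otimes>\<^sub>M \<Sigma> n)" if "n \<ge> 1" for n
    using measurable_compose[OF measurable_overlap[OF S[OF that]] F_meas]
    unfolding g_def case_prod_beta .
  have g_eq: "g n x y = f (overlap n x y)" if "n \<ge> 1" "x \<in> space (\<Sigma> n)" "y \<in> space (\<Sigma> n)" for n x y
    using overlap_bounds[OF S[OF that(1)] that(2,3)] by (simp add: g_def F_def)
  have g_sym: "g n x y = g n y x" for n x y by (simp add: g_def overlap_commute[of n x y])
  have g_bound: "\<bar>g n x y\<bar> \<le> B" for n x y by (simp add: g_def F_bound)
  define v where "v n e \<omega> = enn2real (ultrametric_violation (\<mu> n \<omega>) (g n) e)" for n e \<omega>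
  have v_meas: "v n e \<in> borel_measurable (P n)" if n: "n \<ge> 1" for n e
  proof -
    note [measurable] = g_meas[OF n]
    have "(\<lambda>(x, y, z). of_bool (g n x y < min (g n x z) (g n y z) - e) :: ennreal)
        \<in> borel_measurable (\<Sigma> n \<Otimes>\<^sub>M \<Sigma> n \<Otimes>\<^sub>M \<Sigma> n)"
      unfolding of_bool_def by measurable
    from measurable_nn_integral_kernel_triple[OF measurable_prob_algebraD[OF \<mu>[OF n]] this]
    show ?thesis unfolding v_def ultrametric_violation_def by measurable
  qed
  have v_le: "ultrametric_violation (\<mu> n \<omega>) (g n) e \<le> 1" if "n \<ge> 1" "\<omega> \<in> space (P n)" for n e \<omega>
    using gibbs_avg_ultrametric(2)[OF G[OF that] g_meas g_eq] that(1) by blast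
  have v_int: "integrable (P n) (v n e)" if n: "n \<ge> 1" for n e
  proof -
    interpret prob_space "P n" by (rule P[OF n])
    have "v n e \<omega> \<le> 1" if "\<omega> \<in> space (P n)" for \<omega>
      using enn2real_mono[OF v_le[OF n that]] by (simp add: v_def)
    then show ?thesis
      by (intro integrable_const_bound[of _ 1] AE_I2 v_meas[OF n]) (auto simp: v_def)
  qed
  \<comment> \<open>Markov's bound for the probability that the violation at tolerance
    \<open>2 * B / k ^ 5\<close> reaches \<open>1 / k ^ 4\<close>, the two values that
    \<open>ex_gibbs_clustering\<close> asks for.\<close>
  define a where "a k n = real (k ^ 4) * (\<integral>\<omega>. v n (2 * B / real (k ^ 5)) \<omega> \<partial>P n)" for k n
  have a_lim: "a k \<longlonglongrightarrow> 0" if k: "k \<ge> 1" for k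
  proof -
    let ?e = "2 * B / real (k ^ 5)"
    let ?I = "\<lambda>n. \<integral>\<omega>. gibbs_avg (\<mu> n \<omega>)
                  (\<lambda>s. of_bool (f (overlap n (s 1) (s 2)) \<ge>
                     min (f (overlap n (s 1) (s 3))) (f (overlap n (s 2) (s 3))) - ?e)) \<partial>P n"
    have "?I \<longlonglongrightarrow> 1" using assms(4) B k by (simp add: generalized_parisi_ansatz_def)
    then have "(\<lambda>n. real (k ^ 4) * (1 - ?I n)) \<longlonglongrightarrow> real (k ^ 4) * (1 - 1)"
      by (intro tendsto_intros)
    moreover have "eventually (\<lambda>n. real (k ^ 4) * (1 - ?I n) = a k n) sequentially"
      using eventually_ge_at_top[of 1]
    proof eventually_elim
      case (elim n)
      interpret prob_space "P n" by (rule P[OF elim])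
      have "?I n = (\<integral>\<omega>. 1 - v n ?e \<omega> \<partial>P n)"
        unfolding v_def
        by (intro Bochner_Integration.integral_cong refl gibbs_avg_ultrametric(1)[OF G[OF elim] g_meas[OF elim] g_eq[OF elim]])
      also have "\<dots> = 1 - (\<integral>\<omega>. v n ?e \<omega> \<partial>P n)" using v_int[OF elim] by (simp add: prob_space)
      finally show ?case by (simp add: a_def)
    qed
    ultimately show ?thesis by (auto dest: Lim_transform_eventually)
  qed
  \<comment> \<open>One \<open>k\<close> for each \<open>n\<close>, growing so slowly that the
    failure bound \<open>a (\<kappa> n) n\<close> vanishes as well.\<close>
  obtain \<kappa> :: "nat \<Rightarrow> nat" where \<kappa>: "\<forall>n. \<kappa> n \<ge> 1" "filterlim \<kappa> at_top sequentially" "(\<lambda>n. a (\<kappa> n) n) \<longlonglongrightarrow> 0"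
    using ex_diagonal_sequence[of a] a_lim by blast
  define \<epsilon> where "\<epsilon> n = a (\<kappa> n) n" for n
  define \<delta> where "\<delta> n = 16 * B / real (\<kappa> n)" for n
  have "\<epsilon> \<longlonglongrightarrow> 0" using \<kappa>(3) unfolding \<epsilon>_def .
  moreover have "\<delta> \<longlonglongrightarrow> 0" unfolding \<delta>_def
    by (intro tendsto_divide_0[OF tendsto_const] filterlim_at_top_imp_at_infinity
        filterlim_compose[OF filterlim_real_sequentially \<kappa>(2)])
  moreover have "\<exists>A\<in>sets (P n). measure (P n) A \<ge> 1 - \<epsilon> n \<and>
      (\<forall>\<omega>\<in>A. \<exists>V E r. hierarchical_clustering (\<Sigma> n) V E r \<and>
        (\<exists>q :: nat \<Rightarrow> real.
          gibbs_avg (\<mu> n \<omega>)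
            (\<lambda>s. \<bar>f (overlap n (s 1) (s 2)) -
                   q (depth V E r (smallest_cluster V E r (s 1) (s 2)))\<bar>) \<le> \<delta> n))"
    if n: "n \<ge> 1" for n
  proof -
    interpret prob_space "P n" by (rule P[OF n])
    let ?k = "\<kappa> n"
    have k: "?k \<ge> 1" using \<kappa>(1) by blast
    let ?e = "2 * B / real (?k ^ 5)" and ?c = "1 / real (?k ^ 4)"
    note [measurable] = v_meas[OF n]
    define A where "A = {\<omega> \<in> space (P n). v n ?e \<omega> < ?c}"
    have A: "A \<in> sets (P n)" unfolding A_def by measurable
    have "prob (space (P n) - A) = prob {\<omega> \<in> space (P n). v n ?e \<omega> \<ge> ?c}"
      by (rule arg_cong[where f = prob]) (auto simp: A_def)
    also have "\<dots> \<le> (\<integral>\<omega>. v n ?e \<omega> \<partial>P n) / ?c"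
      using k by (intro integral_Markov_inequality_measure[OF v_int[OF n], of "{}"]) (auto simp: v_def)
    also have "\<dots> = \<epsilon> n" by (simp add: \<epsilon>_def a_def)
    finally have "measure (P n) A \<ge> 1 - \<epsilon> n" using prob_compl[OF A] by simp
    moreover have "\<exists>V E r. hierarchical_clustering (\<Sigma> n) V E r \<and>
        (\<exists>q :: nat \<Rightarrow> real.
          gibbs_avg (\<mu> n \<omega>)
            (\<lambda>s. \<bar>f (overlap n (s 1) (s 2)) -
                   q (depth V E r (smallest_cluster V E r (s 1) (s 2)))\<bar>) \<le> \<delta> n)" if \<omega>: "\<omega> \<in> A" for \<omega>
    proof -
      have sp: "\<omega> \<in> space (P n)" using \<omega> by (simp add: A_def)
      have "ultrametric_violation (\<mu> n \<omega>) (g n) ?e < top"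
        using v_le[OF n sp] by (rule le_less_trans) simp
      then have "ultrametric_violation (\<mu> n \<omega>) (g n) ?e = ennreal (v n ?e \<omega>)"
        by (simp add: v_def)
      also have "\<dots> \<le> ennreal ?c" using \<omega> by (intro ennreal_leI) (simp add: A_def)
      finally show ?thesis unfolding \<delta>_def
        by (intro ex_gibbs_clustering[OF G[OF n sp] g_meas[OF n] g_sym g_bound B g_eq[OF n] k])
    qed
    ultimately show ?thesis using A by blast
  qed
  ultimately show ?thesis by blast
qed

end
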